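(* Let $n$ be a positive integer. The following quantities are all equal: (i) the number of isomorphism classes of Steiner triple systems on $n$ points; (ii) the number of isomorphism classes of idempotent totally symmetric Latin squares of order $n$; (iii) the number of isotopism classes containing idempotent totally symmetric Latin squares of order $n$; (iv) the number of species containing idempotent totally symmetric Latin squares of order $n$; (v) the number of isomorphism classes of totally symmetric loops of order $n+1$; (vi) the number of isomorphism classes of totally symmetric unipotent Latin squares of order $n+1$; (vii) the number of isomorphism classes containing totally symmetric reduced Latin squares of order $n+1$; (viii) the number of isotopism classes containing totally symmetric unipotent Latin squares of order $n+1$; (ix) the number of isotopism classes containing totally symmetric reduced Latin squares of order $n+1$; (x) the number of species containing totally symmetric unipotent Latin squares of order $n+1$; (xi) the number of species containing totally symmetric reduced Latin squares of order $n+1$.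
   Context: A Latin square of order $m$ is a set of $m^2$ triples (row, column, symbol) over $\{1,\dots,m\}$, distinct triples agreeing in at most one coordinate; it is the operation table of a quasigroup, and a loop is a quasigroup with an identity element. The square (or quasigroup) is totally symmetric if it is unchanged by every uniform permutation of the three coordinates of its triples; reduced if its first row and column are $1,\dots,m$ in order; unipotent if all main diagonal entries are equal; idempotent if cell $(i,i)$ contains $i$ for all $i$. An isotopism $(\alpha,\beta,\gamma)\in\mathcal{S}_m^3$ maps $(r,c,s)$ to $(r^\alpha,c^\beta,s^\gamma)$; an isomorphism has $\alpha=\beta=\gamma$. A paratopism is an isotopism combined with a uniform permutation of the triple coordinates; species are paratopism classes. A class "containing" squares with a property means one containing at least one such square. A Steiner triple system on $n$ points is a collection of 3-element subsets (blocks) of an $n$-set such that every pair of points lies in exactly one block; two are isomorphic if a bijection of points maps blocks to blocks. *)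

theory Defs
  imports "HOL-Combinatorics.Permutations"
begin

type_synonym triple = "nat \<times> nat \<times> nat"

definition latin_square :: "nat \<Rightarrow> triple set \<Rightarrow> bool" where
  "latin_square m L \<longleftrightarrow>
     L \<subseteq> {1..m} \<times> {1..m} \<times> {1..m} \<and> card L = m\<^sup>2 \<and>
     (\<forall>(r, c, s) \<in> L. \<forall>(r', c', s') \<in> L. (r, c, s) \<noteq> (r', c', s') \<longrightarrow>
        \<not> (r = r' \<and> c = c') \<and> \<not> (r = r' \<and> s = s') \<and> \<not> (c = c' \<and> s = s'))"

definition latin_squares :: "nat \<Rightarrow> triple set set" where
  "latin_squares m = {L. latin_square m L}"

text \<open>Coordinates are numbered 1, 2, 3; only these indices are ever used.\<close>

definition coord :: "'a \<times> 'a \<times> 'a \<Rightarrow> nat \<Rightarrow> 'a" where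
  "coord t i = (case t of (r, c, s) \<Rightarrow> if i = 1 then r else if i = 2 then c else s)"

definition permute_coords :: "(nat \<Rightarrow> nat) \<Rightarrow> 'a \<times> 'a \<times> 'a \<Rightarrow> 'a \<times> 'a \<times> 'a" where
  "permute_coords \<sigma> t = (coord t (\<sigma> 1), coord t (\<sigma> 2), coord t (\<sigma> 3))"

definition totally_symmetric :: "('a \<times> 'a \<times> 'a) set \<Rightarrow> bool" where
  "totally_symmetric L \<longleftrightarrow> (\<forall>\<sigma>. \<sigma> permutes {1, 2, 3} \<longrightarrow> permute_coords \<sigma> ` L = L)"

definition reduced :: "nat \<Rightarrow> triple set \<Rightarrow> bool" where
  "reduced m L \<longleftrightarrow> (\<forall>i \<in> {1..m}. (1, i, i) \<in> L \<and> (i, 1, i) \<in> L)"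

definition unipotent :: "nat \<Rightarrow> triple set \<Rightarrow> bool" where
  "unipotent m L \<longleftrightarrow> (\<exists>u. \<forall>i \<in> {1..m}. (i, i, u) \<in> L)"

definition idempotent_square :: "nat \<Rightarrow> triple set \<Rightarrow> bool" where
  "idempotent_square m L \<longleftrightarrow> (\<forall>i \<in> {1..m}. (i, i, i) \<in> L)"

definition apply_isotopism ::
  "(nat \<Rightarrow> nat) \<Rightarrow> (nat \<Rightarrow> nat) \<Rightarrow> (nat \<Rightarrow> nat) \<Rightarrow> triple \<Rightarrow> triple" where
  "apply_isotopism \<alpha> \<beta> \<gamma> = (\<lambda>(r, c, s). (\<alpha> r, \<beta> c, \<gamma> s))"

definition isotopic :: "nat \<Rightarrow> triple set \<Rightarrow> triple set \<Rightarrow> bool" where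
  "isotopic m L L' \<longleftrightarrow>
     (\<exists>\<alpha> \<beta> \<gamma>. \<alpha> permutes {1..m} \<and> \<beta> permutes {1..m} \<and> \<gamma> permutes {1..m} \<and>
        apply_isotopism \<alpha> \<beta> \<gamma> ` L = L')"

definition isomorphic_squares :: "nat \<Rightarrow> triple set \<Rightarrow> triple set \<Rightarrow> bool" where
  "isomorphic_squares m L L' \<longleftrightarrow>
     (\<exists>\<alpha>. \<alpha> permutes {1..m} \<and> apply_isotopism \<alpha> \<alpha> \<alpha> ` L = L')"

definition paratopic :: "nat \<Rightarrow> triple set \<Rightarrow> triple set \<Rightarrow> bool" where
  "paratopic m L L' \<longleftrightarrow>
     (\<exists>\<alpha> \<beta> \<gamma> \<sigma>. \<alpha> permutes {1..m} \<and> \<beta> permutes {1..m} \<and> \<gamma> permutes {1..m} \<and>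
        \<sigma> permutes {1, 2, 3} \<and>
        permute_coords \<sigma> ` apply_isotopism \<alpha> \<beta> \<gamma> ` L = L')"

definition quasigroup :: "'a set \<Rightarrow> ('a \<Rightarrow> 'a \<Rightarrow> 'a) \<Rightarrow> bool" where
  "quasigroup Q f \<longleftrightarrow>
     (\<forall>x \<in> Q. \<forall>y \<in> Q. f x y \<in> Q) \<and>
     (\<forall>a \<in> Q. \<forall>b \<in> Q. (\<exists>!x. x \<in> Q \<and> f a x = b) \<and> (\<exists>!y. y \<in> Q \<and> f y a = b))"

definition is_loop :: "'a set \<Rightarrow> ('a \<Rightarrow> 'a \<Rightarrow> 'a) \<Rightarrow> bool" where
  "is_loop Q f \<longleftrightarrow> quasigroup Q f \<and> (\<exists>e \<in> Q. \<forall>x \<in> Q. f e x = x \<and> f x e = x)"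

definition operation_table :: "'a set \<Rightarrow> ('a \<Rightarrow> 'a \<Rightarrow> 'a) \<Rightarrow> ('a \<times> 'a \<times> 'a) set" where
  "operation_table Q f = {(x, y, f x y) | x y. x \<in> Q \<and> y \<in> Q}"

text \<open>Every finite structure is isomorphic to one whose underlying set consists of natural
  numbers, so carriers and point sets range over the finite subsets of nat.
  The values of the operation outside the carrier are irrelevant: two operations
  that agree on the carrier are isomorphic in the sense below, so they are never counted
  separately.\<close>

definition ts_loops :: "nat \<Rightarrow> (nat set \<times> (nat \<Rightarrow> nat \<Rightarrow> nat)) set" where
  "ts_loops m =
     {(Q, f). finite Q \<and> card Q = m \<and> is_loop Q f \<and> totally_symmetric (operation_table Q f)}"

definition isomorphic_quasigroups ::
  "'a set \<times> ('a \<Rightarrow> 'a \<Rightarrow> 'a) \<Rightarrow> 'a set \<times> ('a \<Rightarrow> 'a \<Rightarrow> 'a) \<Rightarrow> bool" where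
  "isomorphic_quasigroups = (\<lambda>(Q, f) (Q', f').
     \<exists>\<phi>. bij_betw \<phi> Q Q' \<and> (\<forall>x \<in> Q. \<forall>y \<in> Q. \<phi> (f x y) = f' (\<phi> x) (\<phi> y)))"

definition steiner_triple_system :: "'a set \<Rightarrow> 'a set set \<Rightarrow> bool" where
  "steiner_triple_system V \<B> \<longleftrightarrow>
     (\<forall>b \<in> \<B>. b \<subseteq> V \<and> card b = 3) \<and>
     (\<forall>x \<in> V. \<forall>y \<in> V. x \<noteq> y \<longrightarrow> (\<exists>!b. b \<in> \<B> \<and> {x, y} \<subseteq> b))"

definition steiner_triple_systems :: "nat \<Rightarrow> (nat set \<times> nat set set) set" where
  "steiner_triple_systems n = {(V, \<B>). finite V \<and> card V = n \<and> steiner_triple_system V \<B>}"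

definition isomorphic_sts :: "'a set \<times> 'a set set \<Rightarrow> 'a set \<times> 'a set set \<Rightarrow> bool" where
  "isomorphic_sts = (\<lambda>(V, \<B>) (V', \<B>'). \<exists>\<phi>. bij_betw \<phi> V V' \<and> (\<lambda>b. \<phi> ` b) ` \<B> = \<B>')"

definition classes_of :: "'a set \<Rightarrow> ('a \<Rightarrow> 'a \<Rightarrow> bool) \<Rightarrow> 'a set set" where
  "classes_of A R = A // {(x, y). x \<in> A \<and> y \<in> A \<and> R x y}"

definition classes_containing ::
  "'a set \<Rightarrow> ('a \<Rightarrow> 'a \<Rightarrow> bool) \<Rightarrow> ('a \<Rightarrow> bool) \<Rightarrow> 'a set set" where
  "classes_containing A R P = {C \<in> classes_of A R. \<exists>x \<in> C. P x}"

end

theory Submission imports Defs begin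

text \<open>
  The triples of pairwise distinct entries of a totally symmetric Latin square are the orderings of
  the members of a set of blocks. If the square is idempotent, the blocks form a Steiner triple
  system on all symbols; if it is unipotent with diagonal entry u, then u is an identity element and
  the blocks form a Steiner triple system on the remaining symbols. In both cases the blocks
  determine the square, so isomorphisms of squares and of systems correspond.

  Paratopic totally symmetric squares are isotopic. Given an isotopism between totally symmetric
  squares, permuting its coordinates and composing yields one of the form (a, a, d). For idempotent
  squares d = a. For unipotent squares d maps identity to identity, and repeating the construction
  with (d, a, a) produces an isomorphism.
\<close>

text \<open>Squares use the fixed symbols \<open>{1..m}\<close>, systems and loops arbitrary finite
  carriers, and isotopism classes may contain squares that are not totally symmetric. So no literal
  bijection of objects is sought: a map to Steiner systems that turns the relation at hand into
  isomorphism of systems, and reaches every system up to isomorphism, already equates the numbers of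
  classes. Each of the other ten counts is compared with (i) in this way. The unipotent case needs
  its second round because the row part of an isotopism (a, a, d) may move the identity. In an
  elementary abelian 2-group, whose table is totally symmetric and unipotent, the translation a x =
  x + t with d = id maps the table to itself, yet a moves the identity unless t = 0. The diagonal
  pins down d only at the identity, the one symbol it holds. With d in the row and column positions,
  the identity row goes to the identity row and determines the third part. An idempotent diagonal
  carries every symbol, so one round suffices there.\<close>

section \<open>Counting classes of equivalence relations\<close>

lemma classes_of_eq_image:
  "classes_of A R = (\<lambda>x. {y \<in> A. R x y}) ` A"
  unfolding classes_of_def quotient_def by auto

lemma class_eq_iff:
  assumes "reflp_on A R" "symp_on A R" "transp_on A R" "x \<in> A" "y \<in> A"
  shows "{z \<in> A. R x z} = {z \<in> A. R y z} \<longleftrightarrow> R x y"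
proof
  assume "{z \<in> A. R x z} = {z \<in> A. R y z}"
  then show "R x y" using assms by (auto dest: reflp_onD)
next
  assume "R x y"
  moreover have "R y x" using calculation assms by (auto dest: symp_onD)
  ultimately show "{z \<in> A. R x z} = {z \<in> A. R y z}"
    using assms by (auto dest: transp_onD)
qed

text \<open>A class with a member satisfying \<open>P\<close> is the class of that member, so
  representatives can be confined to \<open>P\<close> while the class itself still ranges over all
  of \<open>A\<close>.\<close>

lemma classes_containing_eq_image:
  assumes "reflp_on A R" "symp_on A R" "transp_on A R"
  shows "classes_containing A R P = (\<lambda>x. {y \<in> A. R x y}) ` {x \<in> A. P x}"
proof -
  have "{y \<in> A. R x y} \<in> (\<lambda>x. {y \<in> A. R x y}) ` {x \<in> A. P x}"
    if "x \<in> A" "y \<in> A" "R x y" "P y" for x y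
    using class_eq_iff[OF assms that(1,2)] that by blast
  moreover have "x \<in> {y \<in> A. R x y}" if "x \<in> A" for x
    using assms(1) that by (auto dest: reflp_onD)
  ultimately show ?thesis
    unfolding classes_containing_def classes_of_eq_image by blast
qed

lemma classes_of_eq_classes_containing:
  assumes "reflp_on A R"
  shows "classes_of A R = classes_containing A R (\<lambda>_. True)"
  unfolding classes_containing_def classes_of_eq_image
  using assms by (auto dest: reflp_onD)

text \<open>Sending \<open>f x\<close> to \<open>g x\<close> is well defined and injective because
  the fibres agree; \<open>inv_into\<close> merely picks a representative. The bijection equates
  cardinalities of infinite images as well.\<close>

lemma card_image_eq_if_same_kernel:
  assumes "\<And>x y. x \<in> A \<Longrightarrow> y \<in> A \<Longrightarrow> f x = f y \<longleftrightarrow> g x = g y"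
  shows "card (f ` A) = card (g ` A)"
proof (rule bij_betw_same_card)
  show "bij_betw (\<lambda>c. g (inv_into A f c)) (f ` A) (g ` A)"
    unfolding bij_betw_def inj_on_def
  proof (intro conjI ballI impI)
    fix c d assume "c \<in> f ` A" "d \<in> f ` A" "g (inv_into A f c) = g (inv_into A f d)"
    then show "c = d" using assms by (metis f_inv_into_f inv_into_into)
  next
    have "g (inv_into A f (f x)) = g x" if "x \<in> A" for x
      using assms that by (metis f_inv_into_f inv_into_into imageI)
    then show "(\<lambda>c. g (inv_into A f c)) ` f ` A = g ` A"
      by (simp add: image_image cong: image_cong)
  qed
qed

text \<open>The bridge for all counts, with \<open>F\<close> sending squares or loops to Steiner
  systems. Surjectivity holds only up to \<open>S\<close>: a square yields a system on its own
  symbols, whereas systems live on arbitrary finite sets.\<close>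

lemma card_classes_containing_eq:
  assumes R: "reflp_on A R" "symp_on A R" "transp_on A R"
    and S: "reflp_on B S" "symp_on B S" "transp_on B S"
    and F: "\<And>x. x \<in> A \<Longrightarrow> P x \<Longrightarrow> F x \<in> B"
    and RS: "\<And>x y. x \<in> A \<Longrightarrow> P x \<Longrightarrow> y \<in> A \<Longrightarrow> P y \<Longrightarrow> R x y \<longleftrightarrow> S (F x) (F y)"
    and surj: "\<And>b. b \<in> B \<Longrightarrow> \<exists>x \<in> A. P x \<and> S (F x) b"
  shows "card (classes_of B S) = card (classes_containing A R P)"
proof -
  have "classes_of B S = (\<lambda>x. {y \<in> B. S (F x) y}) ` {x \<in> A. P x}"
  proof -
    have "{y \<in> B. S b y} \<in> (\<lambda>x. {y \<in> B. S (F x) y}) ` {x \<in> A. P x}" if b: "b \<in> B" for b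
    proof -
      obtain x where "x \<in> A" "P x" "S (F x) b" using surj[OF b] by blast
      moreover from this have "{y \<in> B. S (F x) y} = {y \<in> B. S b y}"
        using class_eq_iff[OF S F b] by blast
      ultimately show ?thesis by blast
    qed
    then show ?thesis unfolding classes_of_eq_image using F by blast
  qed
  moreover have "card ((\<lambda>x. {y \<in> B. S (F x) y}) ` {x \<in> A. P x}) =
      card ((\<lambda>x. {y \<in> A. R x y}) ` {x \<in> A. P x})"
    by (rule card_image_eq_if_same_kernel) (simp add: class_eq_iff[OF S] class_eq_iff[OF R] F RS)
  ultimately show ?thesis by (simp add: classes_containing_eq_image[OF R])
qed

section \<open>Coordinate permutations and total symmetry\<close>

lemma permutes_123_cases:
  assumes "\<sigma> permutes {1, 2, 3::nat}"
  shows "(\<sigma> 1, \<sigma> 2, \<sigma> 3) \<in> {(1,2,3), (1,3,2), (2,1,3), (2,3,1), (3,1,2), (3,2,1)}"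
proof -
  have "\<sigma> 1 \<in> {1, 2, 3}" "\<sigma> 2 \<in> {1, 2, 3}" "\<sigma> 3 \<in> {1, 2, 3}"
    using permutes_in_image[OF assms] by blast+
  moreover have "\<sigma> 1 \<noteq> \<sigma> 2" "\<sigma> 1 \<noteq> \<sigma> 3" "\<sigma> 2 \<noteq> \<sigma> 3"
    by (simp_all add: inj_eq[OF permutes_inj[OF assms]])
  ultimately show ?thesis unfolding insert_iff empty_iff prod.inject by metis
qed

lemma coord_permute_coords:
  "i \<in> {1, 2, 3} \<Longrightarrow> coord (permute_coords \<sigma> t) i = coord t (\<sigma> i)"
  by (auto simp: coord_def permute_coords_def)

text \<open>Coordinate \<open>i\<close> of the result is the old coordinate
  \<open>\<sigma> i\<close>, so composition reverses the order. The assumption keeps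
  \<open>\<sigma> i\<close> among 1, 2, 3, where \<open>coord_permute_coords\<close>
  applies.\<close>

lemma permute_coords_permute_coords:
  assumes "\<sigma> permutes {1, 2, 3}"
  shows "permute_coords \<sigma> (permute_coords \<tau> t) = permute_coords (\<tau> \<circ> \<sigma>) t"
proof -
  have "\<sigma> 1 \<in> {1, 2, 3}" "\<sigma> 2 \<in> {1, 2, 3}" "\<sigma> 3 \<in> {1, 2, 3}"
    using permutes_in_image[OF assms] by blast+
  then show ?thesis
    unfolding permute_coords_def[of \<sigma>] permute_coords_def[of "\<tau> \<circ> \<sigma>"]
    by (simp only: coord_permute_coords o_apply)
qed

lemma permute_coords_id [simp]: "permute_coords id t = t"
  by (cases t) (simp add: permute_coords_def coord_def)

lemma permute_coords_image_cancel:
  assumes "\<sigma> permutes {1, 2, 3}"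
  shows "permute_coords \<sigma> ` permute_coords (inv \<sigma>) ` L = L"
    and "permute_coords (inv \<sigma>) ` permute_coords \<sigma> ` L = L"
  by (simp_all only: image_image permute_coords_permute_coords[OF assms] permutes_inv_o[OF assms]
      permute_coords_permute_coords[OF permutes_inv[OF assms]] permute_coords_id image_ident)

text \<open>The transpositions (1 2) and (2 3) generate all six permutations. Closure under each of
  them gives only inclusions; applying \<open>\<sigma>\<close> to the inclusion for its inverse
  gives the reverse ones.\<close>

lemma totally_symmetric_iff:
  "totally_symmetric L \<longleftrightarrow> (\<forall>x y z. (x, y, z) \<in> L \<longrightarrow> (y, x, z) \<in> L \<and> (x, z, y) \<in> L)"
proof
  assume L: "totally_symmetric L"
  show "\<forall>x y z. (x, y, z) \<in> L \<longrightarrow> (y, x, z) \<in> L \<and> (x, z, y) \<in> L"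
  proof (intro allI impI)
    fix x y z assume t: "(x, y, z) \<in> L"
    have "permute_coords \<sigma> (x, y, z) \<in> L" if "\<sigma> permutes {1, 2, 3}" for \<sigma>
      using L t that unfolding totally_symmetric_def by blast
    from this[of "transpose 1 2"] this[of "transpose 2 3"]
    show "(y, x, z) \<in> L \<and> (x, z, y) \<in> L"
      by (simp add: permutes_swap_id permute_coords_def coord_def transpose_def)
  qed
next
  assume s: "\<forall>x y z. (x, y, z) \<in> L \<longrightarrow> (y, x, z) \<in> L \<and> (x, z, y) \<in> L"
  have sub: "permute_coords \<sigma> ` L \<subseteq> L" if "\<sigma> permutes {1, 2, 3}" for \<sigma>
  proof
    fix t assume "t \<in> permute_coords \<sigma> ` L"
    then obtain x y z where "(x, y, z) \<in> L" "t = permute_coords \<sigma> (x, y, z)" by auto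
    moreover from this have "(x, z, y) \<in> L" "(y, x, z) \<in> L" "(y, z, x) \<in> L" "(z, x, y) \<in> L" "(z, y, x) \<in> L"
      using s by blast+
    ultimately show "t \<in> L" using permutes_123_cases[OF that]
      by (auto simp: permute_coords_def coord_def)
  qed
  show "totally_symmetric L"
    unfolding totally_symmetric_def
    proof (intro allI impI subset_antisym)
    fix \<sigma> :: "nat \<Rightarrow> nat" assume \<sigma>: "\<sigma> permutes {1, 2, 3}"
    show "permute_coords \<sigma> ` L \<subseteq> L" by (rule sub[OF \<sigma>])
    show "L \<subseteq> permute_coords \<sigma> ` L"
      using image_mono[OF sub[OF permutes_inv[OF \<sigma>]], of "permute_coords \<sigma>"]
      by (simp only: permute_coords_image_cancel[OF \<sigma>])
  qed
qed

section \<open>Isotopism, isomorphism and paratopism as equivalence relations\<close>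

text \<open>Permutations of \<open>{1..m}\<close> are bijections of all natural numbers, so an
  equation between squares becomes a membership equivalence free of carrier conditions, suited to
  chains of rewriting.\<close>

lemma apply_isotopism_image_eq_iff:
  assumes "bij \<alpha>" "bij \<beta>" "bij \<gamma>"
  shows "apply_isotopism \<alpha> \<beta> \<gamma> ` L = L' \<longleftrightarrow>
    (\<forall>x y z. (\<alpha> x, \<beta> y, \<gamma> z) \<in> L' \<longleftrightarrow> (x, y, z) \<in> L)"
proof
  have "inj (apply_isotopism \<alpha> \<beta> \<gamma>)"
    using assms by (intro injI) (auto simp: apply_isotopism_def bij_def inj_eq)
  moreover assume "apply_isotopism \<alpha> \<beta> \<gamma> ` L = L'"
  ultimately have "apply_isotopism \<alpha> \<beta> \<gamma> (x, y, z) \<in> L' \<longleftrightarrow> (x, y, z) \<in> L" for x y z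
    using inj_image_mem_iff by metis
  then show "\<forall>x y z. (\<alpha> x, \<beta> y, \<gamma> z) \<in> L' \<longleftrightarrow> (x, y, z) \<in> L"
    by (simp add: apply_isotopism_def)
next
  assume h: "\<forall>x y z. (\<alpha> x, \<beta> y, \<gamma> z) \<in> L' \<longleftrightarrow> (x, y, z) \<in> L"
  have "(x', y', z') \<in> apply_isotopism \<alpha> \<beta> \<gamma> ` L" if "(x', y', z') \<in> L'" for x' y' z'
  proof -
    obtain x y z where "x' = \<alpha> x" "y' = \<beta> y" "z' = \<gamma> z"
      using assms[THEN bij_is_surj] by (metis surjD)
    then have "(x, y, z) \<in> L" "(x', y', z') = apply_isotopism \<alpha> \<beta> \<gamma> (x, y, z)"
      using h that by (simp_all add: apply_isotopism_def)
    then show ?thesis by blast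
  qed
  then show "apply_isotopism \<alpha> \<beta> \<gamma> ` L = L'"
    using h by (auto simp: apply_isotopism_def)
qed

lemma apply_isotopism_compose:
  "apply_isotopism \<alpha> \<beta> \<gamma> (apply_isotopism \<alpha>' \<beta>' \<gamma>' t) = apply_isotopism (\<alpha> \<circ> \<alpha>') (\<beta> \<circ> \<beta>') (\<gamma> \<circ> \<gamma>') t"
  by (cases t) (simp add: apply_isotopism_def)

lemma apply_isotopism_id [simp]: "apply_isotopism id id id t = t"
  by (cases t) (simp add: apply_isotopism_def)

lemma apply_isotopism_inv_image:
  assumes "\<alpha> permutes S" "\<beta> permutes S" "\<gamma> permutes S"
  shows "apply_isotopism (inv \<alpha>) (inv \<beta>) (inv \<gamma>) ` apply_isotopism \<alpha> \<beta> \<gamma> ` L = L"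
  by (simp add: image_image apply_isotopism_compose permutes_inv_o[OF assms(1)]
      permutes_inv_o[OF assms(2)] permutes_inv_o[OF assms(3)])

text \<open>Coordinate permutations normalise the isotopisms: the three components are permuted
  along. Being polymorphic, \<open>coord\<close> also selects from the triple
  \<open>(\<alpha>, \<beta>, \<gamma>)\<close>.\<close>

lemma permute_coords_apply_isotopism:
  assumes "\<alpha> permutes S" "\<beta> permutes S" "\<gamma> permutes S"
  obtains \<alpha>' \<beta>' \<gamma>' where "\<alpha>' permutes S" "\<beta>' permutes S" "\<gamma>' permutes S"
    "\<And>t. permute_coords \<sigma> (apply_isotopism \<alpha> \<beta> \<gamma> t) = apply_isotopism \<alpha>' \<beta>' \<gamma>' (permute_coords \<sigma> t)"
proof -
  have "coord (\<alpha>, \<beta>, \<gamma>) i permutes S" for i using assms by (simp add: coord_def)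
  moreover have "permute_coords \<sigma> (apply_isotopism \<alpha> \<beta> \<gamma> t) =
      apply_isotopism (coord (\<alpha>, \<beta>, \<gamma>) (\<sigma> 1)) (coord (\<alpha>, \<beta>, \<gamma>) (\<sigma> 2)) (coord (\<alpha>, \<beta>, \<gamma>) (\<sigma> 3))
        (permute_coords \<sigma> t)" for t
    by (cases t) (simp add: permute_coords_def apply_isotopism_def coord_def)
  ultimately show thesis using that by blast
qed

lemma isotopic_refl: "isotopic m L L"
  unfolding isotopic_def
  by (rule exI[of _ id], rule exI[of _ id], rule exI[of _ id]) (simp add: permutes_id)

lemma isotopic_sym: "isotopic m L L' \<Longrightarrow> isotopic m L' L"
  unfolding isotopic_def
  by (elim exE conjE, hypsubst, intro exI conjI, rule permutes_inv, assumption, rule permutes_inv,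
      assumption, rule permutes_inv, assumption, rule apply_isotopism_inv_image)

lemma isotopic_trans:
  assumes "isotopic m L L'" "isotopic m L' L''" shows "isotopic m L L''"
proof -
  obtain a b c where 1: "a permutes {1..m}" "b permutes {1..m}" "c permutes {1..m}"
    "apply_isotopism a b c ` L = L'" using assms(1) unfolding isotopic_def by blast
  obtain a' b' c' where 2: "a' permutes {1..m}" "b' permutes {1..m}" "c' permutes {1..m}"
    "apply_isotopism a' b' c' ` L' = L''" using assms(2) unfolding isotopic_def by blast
  have "apply_isotopism (a' \<circ> a) (b' \<circ> b) (c' \<circ> c) ` L = L''"
    using 1(4) 2(4) by (auto simp: image_image apply_isotopism_compose)
  then show ?thesis using permutes_compose[OF 1(1) 2(1)] permutes_compose[OF 1(2) 2(2)]
      permutes_compose[OF 1(3) 2(3)] unfolding isotopic_def by blast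
qed

lemma isomorphic_squares_refl: "isomorphic_squares m L L"
  unfolding isomorphic_squares_def by (rule exI[of _ id]) (simp add: permutes_id)

lemma isomorphic_squares_sym: "isomorphic_squares m L L' \<Longrightarrow> isomorphic_squares m L' L"
  unfolding isomorphic_squares_def
  by (elim exE conjE, hypsubst, intro exI conjI, rule permutes_inv, assumption,
      rule apply_isotopism_inv_image)

lemma isomorphic_squares_trans:
  assumes "isomorphic_squares m L L'" "isomorphic_squares m L' L''"
  shows "isomorphic_squares m L L''"
proof -
  obtain a where 1: "a permutes {1..m}" "apply_isotopism a a a ` L = L'"
    using assms(1) unfolding isomorphic_squares_def by blast
  obtain a' where 2: "a' permutes {1..m}" "apply_isotopism a' a' a' ` L' = L''"
    using assms(2) unfolding isomorphic_squares_def by blast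
  have "apply_isotopism (a' \<circ> a) (a' \<circ> a) (a' \<circ> a) ` L = L''"
    using 1(2) 2(2) by (auto simp: image_image apply_isotopism_compose)
  then show ?thesis using permutes_compose[OF 1(1) 2(1)] unfolding isomorphic_squares_def by blast
qed

text \<open>Moving the coordinate permutation to the other square, as its inverse, separates it from
  the isotopism, so that the equivalence properties reduce to those of isotopism.\<close>

lemma paratopic_iff:
  "paratopic m L L' \<longleftrightarrow> (\<exists>\<sigma>. \<sigma> permutes {1, 2, 3} \<and> isotopic m L (permute_coords \<sigma> ` L'))"
proof
  assume "paratopic m L L'"
  then obtain a b c \<sigma> where *: "a permutes {1..m}" "b permutes {1..m}" "c permutes {1..m}"
    "\<sigma> permutes {1, 2, 3}" "permute_coords \<sigma> ` apply_isotopism a b c ` L = L'"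
    unfolding paratopic_def by blast
  then have "apply_isotopism a b c ` L = permute_coords (inv \<sigma>) ` L'"
    using permute_coords_image_cancel(2)[OF *(4)] by metis
  then show "\<exists>\<sigma>. \<sigma> permutes {1, 2, 3} \<and> isotopic m L (permute_coords \<sigma> ` L')"
    using * permutes_inv[OF *(4)] unfolding isotopic_def by blast
next
  assume "\<exists>\<sigma>. \<sigma> permutes {1, 2, 3} \<and> isotopic m L (permute_coords \<sigma> ` L')"
  then obtain a b c \<sigma> where *: "a permutes {1..m}" "b permutes {1..m}" "c permutes {1..m}"
    "\<sigma> permutes {1, 2, 3}" "apply_isotopism a b c ` L = permute_coords \<sigma> ` L'"
    unfolding isotopic_def by blast
  then have "permute_coords (inv \<sigma>) ` apply_isotopism a b c ` L = L'"
    using permute_coords_image_cancel(2)[OF *(4)] by metis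
  then show "paratopic m L L'"
    using * permutes_inv[OF *(4)] unfolding paratopic_def by blast
qed

lemma isotopic_permute_coords:
  assumes "isotopic m L L'"
  shows "isotopic m (permute_coords \<sigma> ` L) (permute_coords \<sigma> ` L')"
proof -
  obtain a b c where 1: "a permutes {1..m}" "b permutes {1..m}" "c permutes {1..m}"
    "apply_isotopism a b c ` L = L'" using assms(1) unfolding isotopic_def by blast
  obtain a' b' c' where 2: "a' permutes {1..m}" "b' permutes {1..m}" "c' permutes {1..m}"
    "\<And>t. permute_coords \<sigma> (apply_isotopism a b c t) = apply_isotopism a' b' c' (permute_coords \<sigma> t)"
    using permute_coords_apply_isotopism[OF 1(1-3)] by blast
  have "apply_isotopism a' b' c' ` permute_coords \<sigma> ` L = permute_coords \<sigma> ` L'"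
    using 1(4) by (auto simp: image_image 2(4)[symmetric])
  then show ?thesis using 2 unfolding isotopic_def by blast
qed

lemma paratopic_refl: "paratopic m L L"
  unfolding paratopic_iff by (rule exI[of _ id]) (simp add: permutes_id isotopic_refl)

lemma paratopic_sym: "paratopic m L L' \<Longrightarrow> paratopic m L' L"
  unfolding paratopic_iff
proof (elim exE conjE)
  fix \<sigma> assume \<sigma>: "\<sigma> permutes {1, 2, 3}" and "isotopic m L (permute_coords \<sigma> ` L')"
  then have "isotopic m (permute_coords (inv \<sigma>) ` permute_coords \<sigma> ` L') (permute_coords (inv \<sigma>) ` L)"
    by (blast intro: isotopic_permute_coords[OF isotopic_sym])
  then show "\<exists>\<sigma>. \<sigma> permutes {1, 2, 3} \<and> isotopic m L' (permute_coords \<sigma> ` L)"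
    using permutes_inv[OF \<sigma>] by (auto simp: permute_coords_image_cancel(2)[OF \<sigma>])
qed

lemma paratopic_trans:
  assumes "paratopic m L L'" "paratopic m L' L''" shows "paratopic m L L''"
proof -
  obtain \<sigma> \<tau> where *: "\<sigma> permutes {1, 2, 3}" "isotopic m L (permute_coords \<sigma> ` L')"
    "\<tau> permutes {1, 2, 3}" "isotopic m L' (permute_coords \<tau> ` L'')"
    using assms unfolding paratopic_iff by blast
  have "isotopic m L (permute_coords \<sigma> ` permute_coords \<tau> ` L'')"
    using * isotopic_trans isotopic_permute_coords by blast
  then have "isotopic m L (permute_coords (\<tau> \<circ> \<sigma>) ` L'')"
    by (simp add: image_image permute_coords_permute_coords[OF *(1)])
  then show ?thesis unfolding paratopic_iff using permutes_compose[OF *(1,3)] by blast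
qed

lemma paratopic_iff_isotopic:
  assumes "totally_symmetric L'"
  shows "paratopic m L L' \<longleftrightarrow> isotopic m L L'"
proof -
  have "permute_coords \<sigma> ` L' = L'" if "\<sigma> permutes {1, 2, 3}" for \<sigma>
    using assms that unfolding totally_symmetric_def by blast
  then show ?thesis unfolding paratopic_iff by (metis permutes_id)
qed

section \<open>Totally symmetric tables and their blocks\<close>

text \<open>An arbitrary carrier lets squares on \<open>{1..m}\<close> and loops on any finite set
  share one theory. Uniqueness is required in the third coordinate only, as total symmetry carries
  it over to the other two.\<close>

definition ts_table :: "'a set \<Rightarrow> ('a \<times> 'a \<times> 'a) set \<Rightarrow> bool" where
  "ts_table Q L \<longleftrightarrow> L \<subseteq> Q \<times> Q \<times> Q \<and> totally_symmetric L \<and>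
     (\<forall>x \<in> Q. \<forall>y \<in> Q. \<exists>!z. (x, y, z) \<in> L)"

definition blocks :: "('a \<times> 'a \<times> 'a) set \<Rightarrow> 'a set set" where
  "blocks L = {{x, y, z} | x y z. (x, y, z) \<in> L \<and> x \<noteq> y \<and> y \<noteq> z \<and> x \<noteq> z}"

definition idempotent_table :: "'a set \<Rightarrow> ('a \<times> 'a \<times> 'a) set \<Rightarrow> bool" where
  "idempotent_table Q L \<longleftrightarrow> ts_table Q L \<and> (\<forall>x \<in> Q. (x, x, x) \<in> L)"

definition unipotent_table :: "'a set \<Rightarrow> 'a \<Rightarrow> ('a \<times> 'a \<times> 'a) set \<Rightarrow> bool" where
  "unipotent_table Q u L \<longleftrightarrow> ts_table Q L \<and> u \<in> Q \<and> (\<forall>x \<in> Q. (x, x, u) \<in> L)"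

definition table_isomorphic ::
  "'a set \<Rightarrow> ('a \<times> 'a \<times> 'a) set \<Rightarrow> 'b set \<Rightarrow> ('b \<times> 'b \<times> 'b) set \<Rightarrow> bool" where
  "table_isomorphic Q L Q' L' \<longleftrightarrow> (\<exists>\<phi>. bij_betw \<phi> Q Q' \<and>
     (\<forall>x \<in> Q. \<forall>y \<in> Q. \<forall>z \<in> Q. (\<phi> x, \<phi> y, \<phi> z) \<in> L' \<longleftrightarrow> (x, y, z) \<in> L))"

lemma steiner_block:
  assumes "steiner_triple_system V B" "b \<in> B"
  shows "b \<subseteq> V" "card b = 3"
  using assms by (simp_all add: steiner_triple_system_def)

lemma ts_table_swap:
  assumes "ts_table Q L" "(x, y, z) \<in> L"
  shows "(y, x, z) \<in> L" "(x, z, y) \<in> L"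
  using assms unfolding ts_table_def totally_symmetric_iff by blast+

lemma ts_table_mem:
  assumes "ts_table Q L" "(x, y, z) \<in> L"
  shows "x \<in> Q" "y \<in> Q" "z \<in> Q"
  using assms unfolding ts_table_def by blast+

lemma ts_table_ex: "ts_table Q L \<Longrightarrow> x \<in> Q \<Longrightarrow> y \<in> Q \<Longrightarrow> \<exists>z \<in> Q. (x, y, z) \<in> L"
  using ts_table_mem unfolding ts_table_def by blast

lemma ts_table_unique:
  assumes "ts_table Q L" "(x, y, z) \<in> L" "(x, y, z') \<in> L"
  shows "z = z'"
  using assms ts_table_mem[OF assms(1,2)] unfolding ts_table_def by blast

text \<open>A block forgets the order of its points, but total symmetry puts all six orderings into
  \<open>L\<close>, so nothing is lost.\<close>

lemma mem_blocks_iff: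
  assumes "ts_table Q L" "x \<noteq> y" "y \<noteq> z" "x \<noteq> z"
  shows "{x, y, z} \<in> blocks L \<longleftrightarrow> (x, y, z) \<in> L"
proof
  assume "{x, y, z} \<in> blocks L"
  then obtain a b c where e: "{x, y, z} = {a, b, c}" and t: "(a, b, c) \<in> L"
    unfolding blocks_def by blast
  have "(a, c, b) \<in> L" "(b, a, c) \<in> L" "(b, c, a) \<in> L" "(c, a, b) \<in> L" "(c, b, a) \<in> L"
    using t ts_table_swap[OF assms(1)] by blast+
  moreover have "x \<in> {a, b, c}" "y \<in> {a, b, c}" "z \<in> {a, b, c}" using e by blast+
  ultimately show "(x, y, z) \<in> L" using t assms(2-) by auto
next
  assume "(x, y, z) \<in> L"
  then show "{x, y, z} \<in> blocks L" unfolding blocks_def using assms(2-) by blast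
qed

lemma blocks_elim:
  assumes "b \<in> blocks L"
  obtains x y z where "b = {x, y, z}" "(x, y, z) \<in> L" "x \<noteq> y" "y \<noteq> z" "x \<noteq> z"
  using assms unfolding blocks_def by blast

lemma card_blocks:
  assumes "b \<in> blocks L" shows "card b = 3"
  using assms by (rule blocks_elim) simp

lemma card_3_third_point:
  assumes "card b = 3" "{x, y} \<subseteq> b" "x \<noteq> y"
  obtains w where "b = {x, y, w}" "x \<noteq> w" "y \<noteq> w"
proof -
  have "card (b - {x, y}) = 1" using assms by (simp add: card_Diff_subset)
  then obtain w where "b - {x, y} = {w}" by (rule card_1_singletonE)
  then show thesis using that[of w] assms(2) by blast
qed

section \<open>Steiner systems from idempotent and unipotent tables\<close>

text \<open>Common core of the two cases, with \<open>V\<close> being \<open>Q\<close> or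
  \<open>Q - {u}\<close>. By \<open>dist\<close> the entry in the cell of two distinct points is a
  genuine third point, and its uniqueness makes the block unique; \<open>sub\<close> keeps blocks
  inside \<open>V\<close>.\<close>

lemma steiner_triple_system_blocks:
  assumes L: "ts_table Q L" and V: "V \<subseteq> Q"
    and dist: "\<And>x y z. (x, y, z) \<in> L \<Longrightarrow> x \<in> V \<Longrightarrow> y \<in> V \<Longrightarrow> x \<noteq> y \<Longrightarrow> x \<noteq> z \<and> y \<noteq> z"
    and sub: "\<And>x y z. (x, y, z) \<in> L \<Longrightarrow> x \<noteq> y \<Longrightarrow> y \<noteq> z \<Longrightarrow> x \<noteq> z \<Longrightarrow> x \<in> V \<and> y \<in> V \<and> z \<in> V"
  shows "steiner_triple_system V (blocks L)"
  unfolding steiner_triple_system_def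
proof (intro conjI ballI impI)
  fix b assume "b \<in> blocks L"
  then obtain x y z where b: "b = {x, y, z}" "(x, y, z) \<in> L" "x \<noteq> y" "y \<noteq> z" "x \<noteq> z"
    by (rule blocks_elim)
  then show "b \<subseteq> V" "card b = 3" using sub[OF b(2-)] by auto
next
  fix x y assume xy: "x \<in> V" "y \<in> V" "x \<noteq> y"
  obtain z where z: "(x, y, z) \<in> L" using ts_table_ex[OF L] xy V by blast
  have d: "x \<noteq> z" "y \<noteq> z" using dist[OF z] xy by blast+
  show "\<exists>!b. b \<in> blocks L \<and> {x, y} \<subseteq> b"
  proof (rule ex1I[of _ "{x, y, z}"])
    show "{x, y, z} \<in> blocks L \<and> {x, y} \<subseteq> {x, y, z}"
      using mem_blocks_iff[OF L] z xy d by blast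
  next
    fix b assume b: "b \<in> blocks L \<and> {x, y} \<subseteq> b"
    obtain w where w: "b = {x, y, w}" "x \<noteq> w" "y \<noteq> w"
      using card_3_third_point[of b x y] card_blocks[of b L] b xy(3) by blast
    then have "(x, y, w) \<in> L" using mem_blocks_iff[OF L] b xy by blast
    then show "b = {x, y, z}" using ts_table_unique[OF L z] w by blast
  qed
qed

lemma steiner_triple_system_idempotent:
  assumes "idempotent_table Q L"
  shows "steiner_triple_system Q (blocks L)"
proof (rule steiner_triple_system_blocks)
  show L: "ts_table Q L" using assms unfolding idempotent_table_def by blast
  show "Q \<subseteq> Q" ..
  fix x y z assume t: "(x, y, z) \<in> L"
  then show "x \<in> Q \<and> y \<in> Q \<and> z \<in> Q" using ts_table_mem[OF L] by blast
  have d: "(x, x, x) \<in> L" "(y, y, y) \<in> L"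
    using assms t ts_table_mem[OF L] unfolding idempotent_table_def by blast+
  assume "x \<noteq> y"
  \<comment> \<open>If \<open>z = x\<close>, then \<open>(x, x, y)\<close> lies in \<open>L\<close>
    beside \<open>(x, x, x)\<close>, forcing \<open>y = x\<close>; likewise for
    \<open>z = y\<close>.\<close>
  then show "x \<noteq> z \<and> y \<noteq> z"
    using t d ts_table_swap[OF L] ts_table_unique[OF L] by metis
qed

text \<open>The first equivalence compares the triple with \<open>(x, x, u)\<close> by uniqueness;
  the other two are the same fact for reordered triples and make \<open>u\<close> a two-sided
  identity.\<close>

lemma unipotent_table_mem_iff:
  assumes L: "unipotent_table Q u L" and "(x, y, z) \<in> L"
  shows "x = y \<longleftrightarrow> z = u" "x = u \<longleftrightarrow> y = z" "y = u \<longleftrightarrow> x = z"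
proof -
  have ts: "ts_table Q L" and u: "\<And>x. x \<in> Q \<Longrightarrow> (x, x, u) \<in> L"
    using L unfolding unipotent_table_def by blast+
  have *: "x = y \<longleftrightarrow> z = u" if "(x, y, z) \<in> L" for x y z
    using that u ts_table_swap[OF ts] ts_table_unique[OF ts] ts_table_mem[OF ts] by metis
  show "x = y \<longleftrightarrow> z = u" "x = u \<longleftrightarrow> y = z" "y = u \<longleftrightarrow> x = z"
    using assms(2) * ts_table_swap[OF ts] by metis+
qed

text \<open>An entry of a triple is \<open>u\<close> exactly when the other two coincide. Hence
  triples with distinct entries avoid \<open>u\<close>, and distinct points other than
  \<open>u\<close> have a third point distinct from both.\<close>

lemma steiner_triple_system_unipotent:
  assumes "unipotent_table Q u L"
  shows "steiner_triple_system (Q - {u}) (blocks L)"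
proof (rule steiner_triple_system_blocks)
  show L: "ts_table Q L" using assms unfolding unipotent_table_def by blast
  show "Q - {u} \<subseteq> Q" by blast
  fix x y z assume t: "(x, y, z) \<in> L"
  note iff = unipotent_table_mem_iff[OF assms t]
  { assume "x \<noteq> y" "y \<noteq> z" "x \<noteq> z"
    then show "x \<in> Q - {u} \<and> y \<in> Q - {u} \<and> z \<in> Q - {u}" using iff t ts_table_mem[OF L] by blast }
  assume "x \<in> Q - {u}" "y \<in> Q - {u}" "x \<noteq> y"
  then show "x \<noteq> z \<and> y \<noteq> z" using iff by blast
qed

section \<open>Isomorphisms of tables and of their Steiner systems\<close>

lemma image_blocks_of_isomorphism:
  assumes \<phi>: "bij_betw \<phi> Q Q'" and L: "ts_table Q L" and L': "ts_table Q' L'"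
    and iso: "\<And>x y z. x \<in> Q \<Longrightarrow> y \<in> Q \<Longrightarrow> z \<in> Q \<Longrightarrow> (\<phi> x, \<phi> y, \<phi> z) \<in> L' \<longleftrightarrow> (x, y, z) \<in> L"
  shows "(\<lambda>b. \<phi> ` b) ` blocks L = blocks L'"
proof (intro subset_antisym subsetI)
  have inj: "\<phi> x = \<phi> y \<longleftrightarrow> x = y" if "x \<in> Q" "y \<in> Q" for x y
    using \<phi> that by (auto simp: bij_betw_def inj_on_eq_iff)
  {
    fix b' assume "b' \<in> (\<lambda>b. \<phi> ` b) ` blocks L"
    then obtain x y z where b: "b' = \<phi> ` {x, y, z}" "(x, y, z) \<in> L" "x \<noteq> y" "y \<noteq> z" "x \<noteq> z"
      unfolding blocks_def by blast
    have Q: "x \<in> Q" "y \<in> Q" "z \<in> Q" using ts_table_mem[OF L b(2)] .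
    have "(\<phi> x, \<phi> y, \<phi> z) \<in> L'" "\<phi> x \<noteq> \<phi> y" "\<phi> y \<noteq> \<phi> z" "\<phi> x \<noteq> \<phi> z"
      using b iso Q by (simp_all add: inj)
    then show "b' \<in> blocks L'" using b(1) unfolding blocks_def by auto
  next
    fix b' assume "b' \<in> blocks L'"
    then obtain x' y' z' where b: "b' = {x', y', z'}" "(x', y', z') \<in> L'" "x' \<noteq> y'" "y' \<noteq> z'" "x' \<noteq> z'"
      by (rule blocks_elim)
    have "x' \<in> Q'" "y' \<in> Q'" "z' \<in> Q'" using ts_table_mem[OF L' b(2)] .
    then obtain x y z where Q: "x \<in> Q" "y \<in> Q" "z \<in> Q" "x' = \<phi> x" "y' = \<phi> y" "z' = \<phi> z"
      using \<phi> unfolding bij_betw_def by blast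
    then have "{x, y, z} \<in> blocks L" using b iso[of x y z] unfolding blocks_def by blast
    moreover have "b' = \<phi> ` {x, y, z}" using b Q by simp
    ultimately show "b' \<in> (\<lambda>b. \<phi> ` b) ` blocks L" by blast
  }
qed

text \<open>Injectivity of \<open>\<phi>\<close> on \<open>V\<close> makes taking images injective
  on subsets of \<open>V\<close>, so the image of a set is a block only if the set is one.
  \<open>V\<close> is separate from \<open>Q\<close> because the identity of a unipotent table is no
  point.\<close>

lemma distinct_triple_iff_of_image_blocks:
  assumes \<phi>: "bij_betw \<phi> V V'" and L: "ts_table Q L" and L': "ts_table Q' L'"
    and sts: "steiner_triple_system V (blocks L)"
    and img: "(\<lambda>b. \<phi> ` b) ` blocks L = blocks L'"
    and xyz: "x \<in> V" "y \<in> V" "z \<in> V" "x \<noteq> y" "y \<noteq> z" "x \<noteq> z"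
  shows "(\<phi> x, \<phi> y, \<phi> z) \<in> L' \<longleftrightarrow> (x, y, z) \<in> L"
proof -
  have inj: "inj_on \<phi> V" using \<phi> by (rule bij_betw_imp_inj_on)
  have sub: "blocks L \<subseteq> Pow V"
    using steiner_block(1)[OF sts] by blast
  have "\<phi> ` {x, y, z} \<in> (\<lambda>b. \<phi> ` b) ` blocks L \<longleftrightarrow> {x, y, z} \<in> blocks L"
    using xyz by (intro inj_on_image_mem_iff[OF inj_on_image_Pow[OF inj] _ sub]) simp
  then have "{\<phi> x, \<phi> y, \<phi> z} \<in> blocks L' \<longleftrightarrow> {x, y, z} \<in> blocks L" using img by simp
  moreover have "\<phi> x \<noteq> \<phi> y" "\<phi> y \<noteq> \<phi> z" "\<phi> x \<noteq> \<phi> z"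
    using inj xyz by (simp_all add: inj_on_eq_iff)
  ultimately show ?thesis using mem_blocks_iff[OF L'] mem_blocks_iff[OF L] xyz by blast
qed

text \<open>Settles the triples that blocks do not record: two equal entries can be moved to the
  front, where the diagonal triple fixes the remaining one.\<close>

lemma idempotent_table_nondistinct_iff:
  assumes L: "idempotent_table Q L" and Q: "x \<in> Q" "y \<in> Q" "z \<in> Q"
    and nd: "\<not> (x \<noteq> y \<and> y \<noteq> z \<and> x \<noteq> z)"
  shows "(x, y, z) \<in> L \<longleftrightarrow> x = y \<and> y = z"
proof -
  have ts: "ts_table Q L" and i: "\<And>x. x \<in> Q \<Longrightarrow> (x, x, x) \<in> L"
    using L unfolding idempotent_table_def by blast+
  show ?thesis using Q nd i ts_table_swap[OF ts] ts_table_unique[OF ts] by metis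
qed

lemma table_isomorphic_idempotent_iff:
  assumes "idempotent_table Q L" "idempotent_table Q' L'"
  shows "table_isomorphic Q L Q' L' \<longleftrightarrow> isomorphic_sts (Q, blocks L) (Q', blocks L')"
proof
  have L: "ts_table Q L" and L': "ts_table Q' L'" using assms unfolding idempotent_table_def by blast+
  {
    assume "table_isomorphic Q L Q' L'"
    then obtain \<phi> where \<phi>: "bij_betw \<phi> Q Q'"
      "\<And>x y z. x \<in> Q \<Longrightarrow> y \<in> Q \<Longrightarrow> z \<in> Q \<Longrightarrow> (\<phi> x, \<phi> y, \<phi> z) \<in> L' \<longleftrightarrow> (x, y, z) \<in> L"
      unfolding table_isomorphic_def by blast
    then show "isomorphic_sts (Q, blocks L) (Q', blocks L')"
      unfolding isomorphic_sts_def prod.case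
      using image_blocks_of_isomorphism[OF \<phi>(1) L L' \<phi>(2)] by blast
  next
    assume "isomorphic_sts (Q, blocks L) (Q', blocks L')"
    then obtain \<phi> where \<phi>: "bij_betw \<phi> Q Q'" "(\<lambda>b. \<phi> ` b) ` blocks L = blocks L'"
      unfolding isomorphic_sts_def prod.case by blast
    have "(\<phi> x, \<phi> y, \<phi> z) \<in> L' \<longleftrightarrow> (x, y, z) \<in> L" if Q: "x \<in> Q" "y \<in> Q" "z \<in> Q" for x y z
    proof (cases "x \<noteq> y \<and> y \<noteq> z \<and> x \<noteq> z")
      case True
      then show ?thesis
        using distinct_triple_iff_of_image_blocks[OF \<phi>(1) L L' steiner_triple_system_idempotent[OF assms(1)] \<phi>(2)]
          Q by blast
    next
      case False
      have "\<phi> x \<in> Q'" "\<phi> y \<in> Q'" "\<phi> z \<in> Q'" using Q \<phi>(1) by (auto simp: bij_betw_def)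
      moreover have "\<phi> x = \<phi> y \<longleftrightarrow> x = y" "\<phi> y = \<phi> z \<longleftrightarrow> y = z" "\<phi> x = \<phi> z \<longleftrightarrow> x = z"
        using Q \<phi>(1) by (auto simp: bij_betw_def inj_on_eq_iff)
      ultimately show ?thesis
        using False Q idempotent_table_nondistinct_iff[OF assms(1)] idempotent_table_nondistinct_iff[OF assms(2)]
        by metis
    qed
    then show "table_isomorphic Q L Q' L'" unfolding table_isomorphic_def using \<phi>(1) by blast
  }
qed

text \<open>The assumption \<open>nd\<close> is the complement of having distinct entries different
  from \<open>u\<close>, so together with the blocks every triple is covered. The criterion uses
  equations only, so injections matching the identities preserve it.\<close>

lemma unipotent_table_nondistinct_iff:
  assumes L: "unipotent_table Q u L" and Q: "x \<in> Q" "y \<in> Q" "z \<in> Q"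
    and nd: "x = y \<or> y = z \<or> x = z \<or> x = u \<or> y = u \<or> z = u"
  shows "(x, y, z) \<in> L \<longleftrightarrow> x = u \<and> y = z \<or> y = u \<and> x = z \<or> z = u \<and> x = y"
proof
  assume "(x, y, z) \<in> L"
  then show "x = u \<and> y = z \<or> y = u \<and> x = z \<or> z = u \<and> x = y"
    using unipotent_table_mem_iff[OF L, of x y z] nd by blast
next
  have ts: "ts_table Q L" and u: "\<And>x. x \<in> Q \<Longrightarrow> (x, x, u) \<in> L"
    using L unfolding unipotent_table_def by blast+
  have *: "(x, x, u) \<in> L" "(x, u, x) \<in> L" "(u, x, x) \<in> L" if "x \<in> Q" for x
    using u[OF that] ts_table_swap[OF ts] by blast+
  assume "x = u \<and> y = z \<or> y = u \<and> x = z \<or> z = u \<and> x = y"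
  then show "(x, y, z) \<in> L" using * Q by (elim disjE conjE) simp_all
qed

lemma table_isomorphic_unipotent_iff:
  assumes U: "unipotent_table Q u L" and U': "unipotent_table Q' u' L'"
  shows "table_isomorphic Q L Q' L' \<longleftrightarrow> isomorphic_sts (Q - {u}, blocks L) (Q' - {u'}, blocks L')"
proof
  have L: "ts_table Q L" "u \<in> Q" and L': "ts_table Q' L'" "u' \<in> Q'"
    using U U' unfolding unipotent_table_def by blast+
  {
    assume "table_isomorphic Q L Q' L'"
    then obtain \<phi> where \<phi>: "bij_betw \<phi> Q Q'"
      "\<And>x y z. x \<in> Q \<Longrightarrow> y \<in> Q \<Longrightarrow> z \<in> Q \<Longrightarrow> (\<phi> x, \<phi> y, \<phi> z) \<in> L' \<longleftrightarrow> (x, y, z) \<in> L"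
      unfolding table_isomorphic_def by blast
    have "(u, u, u) \<in> L" using U unfolding unipotent_table_def by blast
    then have "(\<phi> u, \<phi> u, \<phi> u) \<in> L'" using \<phi>(2) L(2) by blast
    \<comment> \<open>The image triple lies in a diagonal cell of \<open>L'\<close>, where the
      symbol is always \<open>u'\<close>.\<close>
    then have "\<phi> u = u'" using unipotent_table_mem_iff(1)[OF U'] by blast
    then have "bij_betw \<phi> (Q - {u}) (Q' - {u'})"
      using \<phi>(1) L(2) unfolding bij_betw_def by (auto simp: inj_on_eq_iff inj_on_diff)
    then show "isomorphic_sts (Q - {u}, blocks L) (Q' - {u'}, blocks L')"
      unfolding isomorphic_sts_def prod.case
      using image_blocks_of_isomorphism[OF \<phi>(1) L(1) L'(1) \<phi>(2)] by blast
  next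
    assume "isomorphic_sts (Q - {u}, blocks L) (Q' - {u'}, blocks L')"
    then obtain \<psi> where \<psi>: "bij_betw \<psi> (Q - {u}) (Q' - {u'})" "(\<lambda>b. \<psi> ` b) ` blocks L = blocks L'"
      unfolding isomorphic_sts_def prod.case by blast
    \<comment> \<open>The systems say nothing about the identities, so these are matched by
      hand.\<close>
    define \<phi> where "\<phi> = \<psi>(u := u')"
    have eq: "\<phi> u = u'" "\<And>x. x \<noteq> u \<Longrightarrow> \<phi> x = \<psi> x" by (simp_all add: \<phi>_def)
    have \<phi>: "bij_betw \<phi> Q Q'"
    proof -
      have "bij_betw \<phi> (Q - {u}) (Q' - {u'})"
        using \<psi>(1) eq by (subst bij_betw_cong[of _ _ \<psi>]) auto
      then have "bij_betw \<phi> ((Q - {u}) \<union> {u}) ((Q' - {u'}) \<union> {u'})"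
        by (rule bij_betw_combine) (auto simp: eq bij_betw_def)
      then show ?thesis using L(2) L'(2) by (simp add: insert_absorb)
    qed
    have "(\<phi> x, \<phi> y, \<phi> z) \<in> L' \<longleftrightarrow> (x, y, z) \<in> L" if Q: "x \<in> Q" "y \<in> Q" "z \<in> Q" for x y z
    proof (cases "x = y \<or> y = z \<or> x = z \<or> x = u \<or> y = u \<or> z = u")
      case False
      then show ?thesis
        using distinct_triple_iff_of_image_blocks[OF \<psi>(1) L(1) L'(1) steiner_triple_system_unipotent[OF U] \<psi>(2), of x y z]
          Q eq by auto
    next
      case True
      have Q': "\<phi> x \<in> Q'" "\<phi> y \<in> Q'" "\<phi> z \<in> Q'" using Q \<phi> by (auto simp: bij_betw_def)
      have inj: "\<phi> v = \<phi> w \<longleftrightarrow> v = w" if "v \<in> Q" "w \<in> Q" for v w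
        using that \<phi> by (auto simp: bij_betw_def inj_on_eq_iff)
      have iff: "\<phi> x = \<phi> y \<longleftrightarrow> x = y" "\<phi> y = \<phi> z \<longleftrightarrow> y = z" "\<phi> x = \<phi> z \<longleftrightarrow> x = z"
        "\<phi> x = u' \<longleftrightarrow> x = u" "\<phi> y = u' \<longleftrightarrow> y = u" "\<phi> z = u' \<longleftrightarrow> z = u"
        using inj[of x u] inj[of y u] inj[of z u] by (simp_all add: inj Q L(2) eq(1))
      \<comment> \<open>Both criteria are the same Boolean combination of equations, each preserved
        by \<open>\<phi>\<close> according to \<open>iff\<close>; folding \<open>iff\<close> into
        \<open>True\<close> supplies the case assumption for the images.\<close>
      show ?thesis
        unfolding unipotent_table_nondistinct_iff[OF U Q True]
          unipotent_table_nondistinct_iff[OF U' Q' True[folded iff]] iff ..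
    qed
    then show "table_isomorphic Q L Q' L'" unfolding table_isomorphic_def using \<phi> by blast
  }
qed

section \<open>Tables built from Steiner systems\<close>

definition triples_of :: "'a set set \<Rightarrow> ('a \<times> 'a \<times> 'a) set" where
  "triples_of B = {(x, y, z). x \<noteq> y \<and> y \<noteq> z \<and> x \<noteq> z \<and> {x, y, z} \<in> B}"

lemma totally_symmetric_triples_of: "totally_symmetric (triples_of B)"
  unfolding totally_symmetric_iff by (auto simp: triples_of_def insert_commute)

lemma totally_symmetric_Un:
  "totally_symmetric L \<Longrightarrow> totally_symmetric L' \<Longrightarrow> totally_symmetric (L \<union> L')"
  unfolding totally_symmetric_iff by blast

lemma triples_of_ex1:
  assumes S: "steiner_triple_system V B" and xy: "x \<in> V" "y \<in> V" "x \<noteq> y"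
  shows "\<exists>!z. (x, y, z) \<in> triples_of B"
proof -
  obtain b where b: "b \<in> B" "{x, y} \<subseteq> b" and un: "\<And>c. c \<in> B \<Longrightarrow> {x, y} \<subseteq> c \<Longrightarrow> c = b"
    using S xy unfolding steiner_triple_system_def by metis
  have "card b = 3" using steiner_block(2)[OF S b(1)] .
  then obtain w where w: "b = {x, y, w}" "x \<noteq> w" "y \<noteq> w" using card_3_third_point[OF _ b(2) xy(3)] by blast
  show ?thesis
  proof (rule ex1I)
    show "(x, y, w) \<in> triples_of B" using b w xy by (simp add: triples_of_def)
    fix z assume "(x, y, z) \<in> triples_of B"
    then have "{x, y, z} = b" "x \<noteq> z" "y \<noteq> z" using un[of "{x, y, z}"] by (auto simp: triples_of_def)
    then have "z \<in> {x, y, w}" "x \<noteq> z" "y \<noteq> z" using w(1) by blast+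
    then show "z = w" by simp
  qed
qed

lemma triples_of_subset:
  assumes S: "steiner_triple_system V B" and "(x, y, z) \<in> triples_of B"
  shows "x \<in> V" "y \<in> V" "z \<in> V"
proof -
  have "{x, y, z} \<in> B" using assms(2) by (simp add: triples_of_def)
  then have "{x, y, z} \<subseteq> V" by (rule steiner_block(1)[OF S])
  then show "x \<in> V" "y \<in> V" "z \<in> V" by simp_all
qed

text \<open>Since \<open>blocks\<close> ignores triples with repeated entries, such triples can be
  added to \<open>triples_of B\<close> without changing the blocks.\<close>

lemma blocks_eq_if_distinct_triples:
  assumes S: "steiner_triple_system V B"
    and L: "\<And>x y z. x \<noteq> y \<Longrightarrow> y \<noteq> z \<Longrightarrow> x \<noteq> z \<Longrightarrow> (x, y, z) \<in> L \<longleftrightarrow> (x, y, z) \<in> triples_of B"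
  shows "blocks L = B"
proof (intro subset_antisym subsetI)
  fix b assume "b \<in> blocks L"
  then obtain x y z where b: "b = {x, y, z}" "(x, y, z) \<in> L" "x \<noteq> y" "y \<noteq> z" "x \<noteq> z"
    by (rule blocks_elim)
  then show "b \<in> B" using L[OF b(3-5)] by (simp add: triples_of_def)
next
  fix b assume b: "b \<in> B"
  then have "card b = 3" by (rule steiner_block(2)[OF S])
  then obtain x y z where d: "b = {x, y, z}" "x \<noteq> y" "y \<noteq> z" "x \<noteq> z"
    by (auto simp: card_3_iff)
  then have "(x, y, z) \<in> L" using L[OF d(2-4)] b by (simp add: triples_of_def)
  then show "b \<in> blocks L" using d unfolding blocks_def by blast
qed

lemma idempotent_table_of_steiner:
  assumes S: "steiner_triple_system V B"
  obtains L where "idempotent_table V L" "blocks L = B"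
proof
  let ?L = "triples_of B \<union> (\<lambda>x. (x, x, x)) ` V"
  show "blocks ?L = B" by (rule blocks_eq_if_distinct_triples[OF S]) auto
  have "\<exists>!z. (x, y, z) \<in> ?L" if xy: "x \<in> V" "y \<in> V" for x y
  proof (cases "x = y")
    case True
    then show ?thesis using xy by (auto simp: triples_of_def)
  next
    case False
    then have "(x, y, z) \<in> ?L \<longleftrightarrow> (x, y, z) \<in> triples_of B" for z by auto
    then show ?thesis using triples_of_ex1[OF S xy False] by simp
  qed
  moreover have "?L \<subseteq> V \<times> V \<times> V" using triples_of_subset[OF S] by auto
  moreover have "totally_symmetric ?L"
    by (intro totally_symmetric_Un totally_symmetric_triples_of) (auto simp: totally_symmetric_iff)
  ultimately show "idempotent_table V ?L" unfolding idempotent_table_def ts_table_def by auto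
qed

text \<open>The triples forced by \<open>u\<close> being both identity and diagonal symbol, matching
  the criterion in \<open>unipotent_table_nondistinct_iff\<close>.\<close>

definition unit_triples :: "'a set \<Rightarrow> 'a \<Rightarrow> ('a \<times> 'a \<times> 'a) set" where
  "unit_triples Q u = {(x, y, z). x \<in> Q \<and> y \<in> Q \<and> z \<in> Q \<and>
     (x = u \<and> y = z \<or> y = u \<and> x = z \<or> z = u \<and> x = y)}"

lemma mem_unit_triples:
  "(x, y, z) \<in> unit_triples Q u \<longleftrightarrow> x \<in> Q \<and> y \<in> Q \<and> z \<in> Q \<and>
     (x = u \<and> y = z \<or> y = u \<and> x = z \<or> z = u \<and> x = y)"
  by (simp add: unit_triples_def)

lemma totally_symmetric_unit_triples: "totally_symmetric (unit_triples Q u)"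
  unfolding totally_symmetric_iff mem_unit_triples
  by (intro allI impI conjI; elim conjE disjE; simp)

lemma unipotent_table_of_steiner:
  assumes S: "steiner_triple_system V B" and u: "u \<notin> V"
  obtains L where "unipotent_table (insert u V) u L" "blocks L = B"
proof
  let ?Q = "insert u V"
  let ?L = "triples_of B \<union> unit_triples ?Q u"
  have "(x, y, z) \<in> ?L \<longleftrightarrow> (x, y, z) \<in> triples_of B" if "x \<noteq> y" "y \<noteq> z" "x \<noteq> z" for x y z
    using that by (simp add: mem_unit_triples)
  then show "blocks ?L = B" by (rule blocks_eq_if_distinct_triples[OF S])
  \<comment> \<open>Blocks avoid \<open>u\<close> and have distinct points, so row \<open>u\<close>,
    column \<open>u\<close> and the diagonal receive no block triple. Unit triples fill exactly
    these cells, block triples the others.\<close>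
  have nu: "(x, y, z) \<notin> triples_of B" if "x = u \<or> y = u \<or> x = y" for x y z
  proof
    assume t: "(x, y, z) \<in> triples_of B"
    then have "x \<noteq> y" by (simp add: triples_of_def)
    then show False using triples_of_subset(1,2)[OF S t] u that by blast
  qed
  have "\<exists>!z. (x, y, z) \<in> ?L" if xy: "x \<in> ?Q" "y \<in> ?Q" for x y
  proof (cases "x = u \<or> y = u \<or> x = y")
    case True
    then have "(x, y, z) \<in> ?L \<longleftrightarrow> (x, y, z) \<in> unit_triples ?Q u" for z using nu[OF True] by simp
    moreover have "\<exists>!z. (x, y, z) \<in> unit_triples ?Q u"
    proof (rule ex1I)
      \<comment> \<open>The three rules overlap only in cell \<open>(u, u)\<close>, where each
        prescribes \<open>u\<close>.\<close>
      show "(x, y, if x = u then y else if y = u then x else u) \<in> unit_triples ?Q u"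
        using True xy by (simp add: mem_unit_triples) blast
      fix z assume "(x, y, z) \<in> unit_triples ?Q u"
      then show "z = (if x = u then y else if y = u then x else u)"
        unfolding mem_unit_triples by (elim conjE disjE) simp_all
    qed
    ultimately show ?thesis by simp
  next
    case False
    then have "(x, y, z) \<in> ?L \<longleftrightarrow> (x, y, z) \<in> triples_of B" for z
      using xy by (auto simp: mem_unit_triples)
    then show ?thesis using triples_of_ex1[OF S, of x y] xy False by simp
  qed
  then have ex1: "\<forall>x \<in> ?Q. \<forall>y \<in> ?Q. \<exists>!z. (x, y, z) \<in> ?L" by simp
  have "triples_of B \<subseteq> V \<times> V \<times> V" using triples_of_subset[OF S] by auto
  then have sub: "?L \<subseteq> ?Q \<times> ?Q \<times> ?Q" unfolding unit_triples_def by blast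
  have "totally_symmetric ?L"
    by (intro totally_symmetric_Un totally_symmetric_triples_of totally_symmetric_unit_triples)
  moreover have "\<forall>x \<in> ?Q. (x, x, u) \<in> ?L" by (simp add: mem_unit_triples)
  ultimately show "unipotent_table ?Q u ?L"
    unfolding unipotent_table_def ts_table_def using ex1 sub by (intro conjI) simp_all
qed

section \<open>Transport and isomorphism of Steiner systems\<close>

lemma steiner_triple_system_image:
  assumes S: "steiner_triple_system V B" and inj: "inj_on \<phi> V"
  shows "steiner_triple_system (\<phi> ` V) ((\<lambda>b. \<phi> ` b) ` B)"
  unfolding steiner_triple_system_def
proof (intro conjI ballI impI)
  have B: "c \<subseteq> V" "card c = 3" if "c \<in> B" for c
    using steiner_block[OF S that] .
  {
    fix b assume "b \<in> (\<lambda>b. \<phi> ` b) ` B"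
    then obtain c where c: "c \<in> B" "b = \<phi> ` c" by blast
    show "b \<subseteq> \<phi> ` V" unfolding c(2) by (rule image_mono[OF B(1)[OF c(1)]])
    show "card b = 3" unfolding c(2) card_image[OF inj_on_subset[OF inj B(1)[OF c(1)]]]
      by (rule B(2)[OF c(1)])
  next
    fix x' y' assume "x' \<in> \<phi> ` V" "y' \<in> \<phi> ` V" and ne: "x' \<noteq> y'"
    then obtain x y where xy: "x \<in> V" "y \<in> V" "x' = \<phi> x" "y' = \<phi> y" by blast
    have mem: "\<phi> v \<in> \<phi> ` c \<longleftrightarrow> v \<in> c" if "v \<in> V" "c \<in> B" for v c
      using inj_on_image_mem_iff[OF inj that(1) B(1)[OF that(2)]] .
    have "x \<noteq> y" using xy ne by blast
    then have "\<exists>!b. b \<in> B \<and> {x, y} \<subseteq> b"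
      using S xy(1,2) unfolding steiner_triple_system_def by simp
    then obtain b where b: "b \<in> B" "{x, y} \<subseteq> b" and un: "\<And>c. c \<in> B \<Longrightarrow> {x, y} \<subseteq> c \<Longrightarrow> c = b"
      by (elim ex1E) blast
    show "\<exists>!b'. b' \<in> (\<lambda>b. \<phi> ` b) ` B \<and> {x', y'} \<subseteq> b'"
    proof (rule ex1I[of _ "\<phi> ` b"])
      show "\<phi> ` b \<in> (\<lambda>b. \<phi> ` b) ` B \<and> {x', y'} \<subseteq> \<phi> ` b" using b xy by blast
      fix b' assume "b' \<in> (\<lambda>b. \<phi> ` b) ` B \<and> {x', y'} \<subseteq> b'"
      then obtain c where c: "c \<in> B" "b' = \<phi> ` c" "\<phi> x \<in> \<phi> ` c" "\<phi> y \<in> \<phi> ` c"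
        unfolding xy(3,4) by blast
      then have "{x, y} \<subseteq> c" using mem[OF xy(1) c(1)] mem[OF xy(2) c(1)] by simp
      then show "b' = \<phi> ` b" using un c by blast
    qed
  }
qed

lemma isomorphic_sts_refl: "isomorphic_sts S S"
proof (cases S)
  case (Pair V B)
  have "bij_betw id V V" "(\<lambda>b. id ` b) ` B = B" by simp_all
  then show ?thesis unfolding isomorphic_sts_def Pair prod.case by blast
qed

text \<open>Inverting the point map restores a block only if the block consists of points, which is
  why \<open>S\<close> is taken to be a system.\<close>

lemma isomorphic_sts_sym:
  assumes "S \<in> steiner_triple_systems n" "isomorphic_sts S T"
  shows "isomorphic_sts T S"
proof -
  obtain V B V' B' where eq: "S = (V, B)" "T = (V', B')" by (metis surj_pair)
  obtain \<phi> where \<phi>: "bij_betw \<phi> V V'" "(\<lambda>b. \<phi> ` b) ` B = B'"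
    using assms(2) unfolding eq isomorphic_sts_def by auto
  have "b \<subseteq> V" if "b \<in> B" for b
    using assms(1) steiner_block(1)[OF _ that] unfolding eq steiner_triple_systems_def by blast
  then have "inv_into V \<phi> ` \<phi> ` b = b" if "b \<in> B" for b
    using that bij_betw_imp_inj_on[OF \<phi>(1)] by (simp add: inv_into_image_cancel)
  then have "(\<lambda>b. inv_into V \<phi> ` b) ` B' = B" unfolding \<phi>(2)[symmetric] image_image by simp
  then show ?thesis using bij_betw_inv_into[OF \<phi>(1)] unfolding eq isomorphic_sts_def by auto
qed

lemma isomorphic_sts_trans:
  assumes "isomorphic_sts S T" "isomorphic_sts T U"
  shows "isomorphic_sts S U"
proof -
  obtain V B V' B' V'' B'' where eq: "S = (V, B)" "T = (V', B')" "U = (V'', B'')"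
    by (metis surj_pair)
  obtain \<phi> \<psi> where \<phi>: "bij_betw \<phi> V V'" "(\<lambda>b. \<phi> ` b) ` B = B'"
    and \<psi>: "bij_betw \<psi> V' V''" "(\<lambda>b. \<psi> ` b) ` B' = B''"
    using assms unfolding eq isomorphic_sts_def by auto
  have "(\<lambda>b. (\<psi> \<circ> \<phi>) ` b) ` B = B''"
    unfolding \<psi>(2)[symmetric] \<phi>(2)[symmetric] by (simp add: image_image)
  then show ?thesis using bij_betw_trans[OF \<phi>(1) \<psi>(1)] unfolding eq isomorphic_sts_def by auto
qed

section \<open>Totally symmetric Latin squares as tables\<close>

text \<open>Forward, existence comes from counting: as many triples as cells, projected injectively
  to cells, reach every cell. Backward, agreement in row and symbol or in column and symbol becomes
  agreement in the first two coordinates after reordering.\<close>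

lemma latin_square_totally_symmetric_iff:
  "latin_square m L \<and> totally_symmetric L \<longleftrightarrow> ts_table {1..m} L"
proof
  let ?S = "{1..m}" and ?p = "\<lambda>(x, y, z). (x, y)"
  have cardSS: "card (?S \<times> ?S) = m\<^sup>2" by (simp add: card_cartesian_product power2_eq_square)
  {
    assume L: "latin_square m L \<and> totally_symmetric L"
    then have sub: "L \<subseteq> ?S \<times> ?S \<times> ?S" and card: "card L = m\<^sup>2" by (simp_all add: latin_square_def)
    have un: "z = z'" if "(x, y, z) \<in> L" "(x, y, z') \<in> L" for x y z z'
      using L that unfolding latin_square_def by fastforce
    have "inj_on ?p L" by (rule inj_onI) (auto intro: un)
    then have "card (?p ` L) = card (?S \<times> ?S)" using card cardSS by (simp add: card_image)
    moreover have "?p ` L \<subseteq> ?S \<times> ?S" using sub by auto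
    ultimately have "?p ` L = ?S \<times> ?S" by (intro card_subset_eq) simp_all
    then have ex: "\<exists>z. (x, y, z) \<in> L" if "x \<in> ?S" "y \<in> ?S" for x y
    proof -
      have "(x, y) \<in> ?p ` L" using that \<open>?p ` L = ?S \<times> ?S\<close> by simp
      then show ?thesis by auto
    qed
    have "\<exists>!z. (x, y, z) \<in> L" if "x \<in> ?S" "y \<in> ?S" for x y
      using ex[OF that] un by blast
    then show "ts_table ?S L" unfolding ts_table_def using sub L by simp
  next
    assume L: "ts_table ?S L"
    have "inj_on ?p L" by (rule inj_onI) (auto dest: ts_table_unique[OF L])
    moreover have "?p ` L = ?S \<times> ?S"
    proof (intro subset_antisym subsetI)
      fix t assume "t \<in> ?p ` L"
      then obtain x y z where "t = (x, y)" "(x, y, z) \<in> L" by auto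
      then show "t \<in> ?S \<times> ?S" using ts_table_mem(1,2)[OF L] by blast
    next
      fix t assume "t \<in> ?S \<times> ?S"
      then obtain x y where t: "t = (x, y)" "x \<in> ?S" "y \<in> ?S" by blast
      then obtain z where "(x, y, z) \<in> L" using ts_table_ex[OF L] by blast
      then show "t \<in> ?p ` L" using t(1) by (auto intro!: image_eqI[of _ _ "(x, y, z)"])
    qed
    ultimately have "card L = m\<^sup>2" using cardSS by (metis card_image)
    moreover have "\<forall>(r, c, s) \<in> L. \<forall>(r', c', s') \<in> L. (r, c, s) \<noteq> (r', c', s') \<longrightarrow>
        \<not> (r = r' \<and> c = c') \<and> \<not> (r = r' \<and> s = s') \<and> \<not> (c = c' \<and> s = s')"
    proof -
      have "(r, c, s) = (r', c', s')"
        if t: "(r, c, s) \<in> L" "(r', c', s') \<in> L" and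
          d: "r = r' \<and> c = c' \<or> r = r' \<and> s = s' \<or> c = c' \<and> s = s'" for r c s r' c' s'
        using d
      proof (elim disjE conjE)
        assume "r = r'" "c = c'"
        then show ?thesis using ts_table_unique[OF L t(1)] t(2) by simp
      next
        assume e: "r = r'" "s = s'"
        then show ?thesis
          using ts_table_unique[OF L ts_table_swap(2)[OF L t(1)]] ts_table_swap(2)[OF L t(2)] by simp
      next
        assume e: "c = c'" "s = s'"
        have "(c, s, r) \<in> L" using ts_table_swap[OF L] t(1) by blast
        moreover have "(c', s', r') \<in> L" using ts_table_swap[OF L] t(2) by blast
        ultimately show ?thesis using e ts_table_unique[OF L] by blast
      qed
      then show ?thesis by fast
    qed
    ultimately show "latin_square m L \<and> totally_symmetric L"
      using L unfolding latin_square_def ts_table_def by simp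
  }
qed

lemma isomorphic_imp_isotopic: "isomorphic_squares m L L' \<Longrightarrow> isotopic m L L'"
  unfolding isomorphic_squares_def isotopic_def by blast

lemma isomorphic_squaresI:
  assumes "a permutes {1..m}" "\<And>x y z. (a x, a y, a z) \<in> L' \<longleftrightarrow> (x, y, z) \<in> L"
  shows "isomorphic_squares m L L'"
proof -
  have bij: "bij a" using assms(1) by (rule permutes_bij)
  have "apply_isotopism a a a ` L = L'"
    using assms(2) by (simp add: apply_isotopism_image_eq_iff[OF bij bij bij])
  then show ?thesis unfolding isomorphic_squares_def using assms(1) by blast
qed

lemma isomorphic_squares_iff_table_isomorphic:
  assumes L: "ts_table {1..m} L" and L': "ts_table {1..m} L'"
  shows "isomorphic_squares m L L' \<longleftrightarrow> table_isomorphic {1..m} L {1..m} L'"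
proof
  assume "isomorphic_squares m L L'"
  then obtain \<alpha> where \<alpha>: "\<alpha> permutes {1..m}" "apply_isotopism \<alpha> \<alpha> \<alpha> ` L = L'"
    unfolding isomorphic_squares_def by blast
  have bij: "bij \<alpha>" using \<alpha>(1) by (rule permutes_bij)
  have "(\<alpha> x, \<alpha> y, \<alpha> z) \<in> L' \<longleftrightarrow> (x, y, z) \<in> L" for x y z
    using \<alpha>(2) unfolding apply_isotopism_image_eq_iff[OF bij bij bij] by simp
  then show "table_isomorphic {1..m} L {1..m} L'"
    unfolding table_isomorphic_def using permutes_imp_bij[OF \<alpha>(1)] by auto
next
  assume "table_isomorphic {1..m} L {1..m} L'"
  then obtain \<phi> where \<phi>: "bij_betw \<phi> {1..m} {1..m}"
    "\<And>x y z. x \<in> {1..m} \<Longrightarrow> y \<in> {1..m} \<Longrightarrow> z \<in> {1..m} \<Longrightarrow> (\<phi> x, \<phi> y, \<phi> z) \<in> L' \<longleftrightarrow> (x, y, z) \<in> L"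
    unfolding table_isomorphic_def by blast
  \<comment> \<open>\<open>permutes\<close> demands the identity off the carrier, where
    \<open>\<phi>\<close> is arbitrary.\<close>
  define \<alpha> where "\<alpha> x = (if x \<in> {1..m} then \<phi> x else x)" for x
  have "bij_betw \<alpha> {1..m} {1..m}"
    using \<phi>(1) by (subst bij_betw_cong[of _ _ \<phi>]) (auto simp: \<alpha>_def)
  then have \<alpha>: "\<alpha> permutes {1..m}" by (rule bij_imp_permutes) (simp only: \<alpha>_def if_False)
  have "(\<alpha> x, \<alpha> y, \<alpha> z) \<in> L' \<longleftrightarrow> (x, y, z) \<in> L" for x y z
  proof (cases "x \<in> {1..m} \<and> y \<in> {1..m} \<and> z \<in> {1..m}")
    case True
    then show ?thesis using \<phi>(2)[of x y z] by (simp add: \<alpha>_def)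
  next
    case False
    \<comment> \<open>Tables hold carrier triples only, and \<open>\<alpha>\<close> keeps outside
      elements outside, so both sides are false.\<close>
    then have "(x, y, z) \<notin> L" using ts_table_mem[OF L, of x y z] by blast
    moreover have "(\<alpha> x, \<alpha> y, \<alpha> z) \<notin> L'"
      using False ts_table_mem[OF L', of "\<alpha> x" "\<alpha> y" "\<alpha> z"]
      unfolding permutes_in_image[OF \<alpha>] by blast
    ultimately show ?thesis by blast
  qed
  then show "isomorphic_squares m L L'" by (rule isomorphic_squaresI[OF \<alpha>])
qed

section \<open>From isotopism to isomorphism\<close>

lemma totally_symmetric_mem_iff:
  assumes "totally_symmetric L"
  shows "(y, x, z) \<in> L \<longleftrightarrow> (x, y, z) \<in> L" "(x, z, y) \<in> L \<longleftrightarrow> (x, y, z) \<in> L"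
  using assms unfolding totally_symmetric_iff by blast+

text \<open>Permuting the coordinates of the isotopism gives further isotopisms from L to L', and the
  composition of (a, b, c), the inverse of (c, b, a), and (c, a, b) has equal row and column parts.\<close>

lemma isotopism_equal_rows_columns:
  assumes ts: "totally_symmetric L" "totally_symmetric L'"
    and bij: "bij a" "bij b" "bij c"
    and iso: "\<And>x y z. (a x, b y, c z) \<in> L' \<longleftrightarrow> (x, y, z) \<in> L"
  shows "(a x, a y, c (inv a (b z))) \<in> L' \<longleftrightarrow> (x, y, z) \<in> L"
proof -
  have cyc: "(y, z, x) \<in> L \<longleftrightarrow> (x, y, z) \<in> L" and rev: "(z, y, x) \<in> L \<longleftrightarrow> (x, y, z) \<in> L" for x y z
    using totally_symmetric_mem_iff[OF ts(1)] by metis+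
  have cyc': "(y, z, x) \<in> L' \<longleftrightarrow> (x, y, z) \<in> L'" and rev': "(z, y, x) \<in> L' \<longleftrightarrow> (x, y, z) \<in> L'" for x y z
    using totally_symmetric_mem_iff[OF ts(2)] by metis+
  have ab: "b (inv b v) = v" "a (inv a v) = v" for v
    using bij by (simp_all add: bij_is_surj surj_f_inv_f)
  have "(a x, a y, c (inv a (b z))) \<in> L' \<longleftrightarrow> (x, inv b (a y), inv a (b z)) \<in> L"
    using iso[of x "inv b (a y)" "inv a (b z)"] by (simp only: ab)
  also have "\<dots> \<longleftrightarrow> (inv a (b z), inv b (a y), x) \<in> L" by (rule rev)
  also have "\<dots> \<longleftrightarrow> (b z, a y, c x) \<in> L'"
    using iso[of "inv a (b z)" "inv b (a y)" x] by (simp only: ab)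
  also have "\<dots> \<longleftrightarrow> (c x, a y, b z) \<in> L'" by (rule rev')
  also have "\<dots> \<longleftrightarrow> (a y, b z, c x) \<in> L'" by (rule cyc'[symmetric])
  also have "\<dots> \<longleftrightarrow> (y, z, x) \<in> L" by (rule iso)
  also have "\<dots> \<longleftrightarrow> (x, y, z) \<in> L" by (rule cyc)
  finally show ?thesis .
qed

lemma isotopic_equal_rows_columns:
  assumes L: "totally_symmetric L" "totally_symmetric L'" and "isotopic m L L'"
  obtains a d where "a permutes {1..m}" "d permutes {1..m}"
    "\<forall>x y z. (a x, a y, d z) \<in> L' \<longleftrightarrow> (x, y, z) \<in> L"
proof -
  obtain a b c where p: "a permutes {1..m}" "b permutes {1..m}" "c permutes {1..m}"
    and eq: "apply_isotopism a b c ` L = L'"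
    using assms(3) unfolding isotopic_def by blast
  have bij: "bij a" "bij b" "bij c" using p by (auto intro: permutes_bij)
  have iso: "(a x, b y, c z) \<in> L' \<longleftrightarrow> (x, y, z) \<in> L" for x y z
    using eq unfolding apply_isotopism_image_eq_iff[OF bij] by simp
  show thesis
  proof (rule that[OF p(1)])
    show "c \<circ> (inv a \<circ> b) permutes {1..m}" by (intro permutes_compose permutes_inv p)
    show "\<forall>x y z. (a x, a y, (c \<circ> (inv a \<circ> b)) z) \<in> L' \<longleftrightarrow> (x, y, z) \<in> L"
      using isotopism_equal_rows_columns[OF L bij iso] by (simp only: o_apply) simp
  qed
qed

lemma isotopic_iff_isomorphic_idempotent:
  assumes L: "idempotent_table {1..m} L" and L': "idempotent_table {1..m} L'"
  shows "isotopic m L L' \<longleftrightarrow> isomorphic_squares m L L'"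
proof
  assume iso: "isotopic m L L'"
  have ts: "totally_symmetric L" "totally_symmetric L'" "ts_table {1..m} L'"
    using L L' by (simp_all add: idempotent_table_def ts_table_def)
  obtain a d where p: "a permutes {1..m}" "d permutes {1..m}"
    and "\<forall>x y z. (a x, a y, d z) \<in> L' \<longleftrightarrow> (x, y, z) \<in> L"
    by (rule isotopic_equal_rows_columns[OF ts(1,2) iso])
  then have ad: "(a x, a y, d z) \<in> L' \<longleftrightarrow> (x, y, z) \<in> L" for x y z by simp
  have "d x = a x" for x
  proof (cases "x \<in> {1..m}")
    case True
    \<comment> \<open>The image of a diagonal triple of \<open>L\<close> shares its cell with a
      diagonal triple of \<open>L'\<close>.\<close>
    then have "(a x, a x, d x) \<in> L'" using ad L unfolding idempotent_table_def by blast
    moreover have "(a x, a x, a x) \<in> L'"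
      using L' True permutes_in_image[OF p(1), of x] unfolding idempotent_table_def by blast
    ultimately show ?thesis by (rule ts_table_unique[OF ts(3)])
  next
    case False
    then show ?thesis using permutes_not_in[OF p(1)] permutes_not_in[OF p(2)] by simp
  qed
  then show "isomorphic_squares m L L'" using ad by (intro isomorphic_squaresI[OF p(1)]) simp
qed (rule isomorphic_imp_isotopic)

lemma isotopic_iff_isomorphic_unipotent:
  assumes L: "unipotent_table {1..m} u L" and L': "unipotent_table {1..m} u' L'"
  shows "isotopic m L L' \<longleftrightarrow> isomorphic_squares m L L'"
proof
  assume iso: "isotopic m L L'"
  have ts: "totally_symmetric L" "totally_symmetric L'" and tb: "ts_table {1..m} L" and u: "u \<in> {1..m}"
    using L L' by (simp_all add: unipotent_table_def ts_table_def)
  have diag: "(x, x, u) \<in> L" if "x \<in> {1..m}" for x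
    using L that unfolding unipotent_table_def by blast
  obtain a d where p: "a permutes {1..m}" "d permutes {1..m}"
    and "\<forall>x y z. (a x, a y, d z) \<in> L' \<longleftrightarrow> (x, y, z) \<in> L"
    by (rule isotopic_equal_rows_columns[OF ts iso])
  then have ad: "(a x, a y, d z) \<in> L' \<longleftrightarrow> (x, y, z) \<in> L" for x y z by simp
  \<comment> \<open>Reordering puts \<open>d\<close> in first position, which the construction then
    copies into the column part.\<close>
  have "(d x, a y, a z) \<in> L' \<longleftrightarrow> (x, y, z) \<in> L" for x y z
  proof -
    have "(d x, a y, a z) \<in> L' \<longleftrightarrow> (a y, a z, d x) \<in> L'"
      using totally_symmetric_mem_iff[OF ts(2)] by blast
    also have "\<dots> \<longleftrightarrow> (x, y, z) \<in> L" unfolding ad using totally_symmetric_mem_iff[OF ts(1)] by blast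
    finally show ?thesis .
  qed
  then have dd: "(d x, d y, a (inv d (a z))) \<in> L' \<longleftrightarrow> (x, y, z) \<in> L" for x y z
    using isotopism_equal_rows_columns[OF ts permutes_bij[OF p(2)] permutes_bij[OF p(1)] permutes_bij[OF p(1)]]
    by blast
  \<comment> \<open>Wherever \<open>a\<close> sends \<open>u\<close>, this is a diagonal cell of
    \<open>L'\<close>, so its symbol is \<open>u'\<close>.\<close>
  have "(a u, a u, d u) \<in> L'" using ad diag[OF u] by blast
  then have du: "d u = u'" using unipotent_table_mem_iff(1)[OF L'] by blast
  have "a (inv d (a x)) = d x" for x
  proof (cases "x \<in> {1..m}")
    case True
    \<comment> \<open>Row \<open>u\<close> of \<open>L\<close> and row \<open>d u = u'\<close> of
      \<open>L'\<close> repeat the column label as symbol, so the third part must agree with the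
      column part \<open>d\<close>.\<close>
    have "(u, x, x) \<in> L" using diag[OF True] ts_table_swap[OF tb] by blast
    then have "(d u, d x, a (inv d (a x))) \<in> L'" using dd by blast
    then show ?thesis using unipotent_table_mem_iff(2)[OF L'] du by metis
  next
    case False
    then show ?thesis
      using permutes_not_in[OF p(1)] permutes_not_in[OF p(2)] permutes_not_in[OF permutes_inv[OF p(2)]] by simp
  qed
  then show "isomorphic_squares m L L'" using dd by (intro isomorphic_squaresI[OF p(2)]) simp
qed (rule isomorphic_imp_isotopic)

section \<open>Totally symmetric loops\<close>

text \<open>The identity law gives the triples \<open>(e, x, x)\<close>, and reordering them to
  \<open>(x, x, e)\<close> makes \<open>e\<close> the diagonal symbol.\<close>

lemma unipotent_table_operation_table:
  assumes loop: "is_loop Q f" and ts: "totally_symmetric (operation_table Q f)"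
  shows "\<exists>u. unipotent_table Q u (operation_table Q f)"
proof -
  obtain e where e: "e \<in> Q" "\<And>x. x \<in> Q \<Longrightarrow> f e x = x" using loop unfolding is_loop_def by blast
  have closed: "f x y \<in> Q" if "x \<in> Q" "y \<in> Q" for x y
    using loop that unfolding is_loop_def quasigroup_def by blast
  have mem: "(x, y, z) \<in> operation_table Q f \<longleftrightarrow> x \<in> Q \<and> y \<in> Q \<and> z = f x y" for x y z
    unfolding operation_table_def by blast
  have "(x, x, e) \<in> operation_table Q f" if "x \<in> Q" for x
  proof -
    have "(e, x, x) \<in> operation_table Q f" using e that by (simp add: mem)
    then show ?thesis using totally_symmetric_mem_iff[OF ts] by blast
  qed
  moreover have "operation_table Q f \<subseteq> Q \<times> Q \<times> Q"
    using closed unfolding operation_table_def by auto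
  moreover have "\<forall>x \<in> Q. \<forall>y \<in> Q. \<exists>!z. (x, y, z) \<in> operation_table Q f" by (simp add: mem)
  ultimately have "unipotent_table Q e (operation_table Q f)"
    unfolding unipotent_table_def ts_table_def using e(1) ts by simp
  then show ?thesis ..
qed

lemma loop_of_unipotent_table:
  assumes L: "unipotent_table Q u L"
  obtains f where "is_loop Q f" "operation_table Q f = L"
proof
  have ts: "ts_table Q L" and u: "u \<in> Q" using L unfolding unipotent_table_def by blast+
  define f where "f x y = (THE z. (x, y, z) \<in> L)" for x y
  have f: "f x y = z \<longleftrightarrow> (x, y, z) \<in> L" if "x \<in> Q" "y \<in> Q" for x y z
  proof -
    have ex1: "\<exists>!z. (x, y, z) \<in> L" using ts that unfolding ts_table_def by blast
    show ?thesis unfolding f_def using theI'[OF ex1] the1_equality[OF ex1] by blast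
  qed
  have "(x, y, z) \<in> operation_table Q f \<longleftrightarrow> (x, y, z) \<in> L" for x y z
    using f[of x y z] ts_table_mem[OF ts, of x y z] unfolding operation_table_def by blast
  then show "operation_table Q f = L" by (auto simp: set_eq_iff)
  have closed: "f x y \<in> Q" if "x \<in> Q" "y \<in> Q" for x y
    using f[OF that] ts_table_mem(3)[OF ts] by blast
  have "\<exists>!x. x \<in> Q \<and> f a x = b" "\<exists>!y. y \<in> Q \<and> f y a = b" if ab: "a \<in> Q" "b \<in> Q" for a b
  proof -
    \<comment> \<open>By symmetry both division problems are solved by the product of
      \<open>a\<close> and \<open>b\<close>, so one uniqueness statement settles both.\<close>
    have 1: "x \<in> Q \<and> f a x = b \<longleftrightarrow> (a, b, x) \<in> L" for x
      using f[OF ab(1), of x b] ts_table_swap(2)[OF ts] ts_table_mem(3)[OF ts] by blast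
    have 2: "y \<in> Q \<and> f y a = b \<longleftrightarrow> (a, b, y) \<in> L" for y
      using f[OF _ ab(1), of y b] ts_table_swap[OF ts] ts_table_mem(3)[OF ts] by blast
    have "\<exists>!x. (a, b, x) \<in> L" using ts ab unfolding ts_table_def by blast
    then show "\<exists>!x. x \<in> Q \<and> f a x = b" "\<exists>!y. y \<in> Q \<and> f y a = b" unfolding 1 2 by simp_all
  qed
  then have "quasigroup Q f" unfolding quasigroup_def using closed by simp
  moreover have "f u x = x" "f x u = x" if "x \<in> Q" for x
    using f[OF u that] f[OF that u] unipotent_table_nondistinct_iff[OF L] u that by blast+
  ultimately show "is_loop Q f" unfolding is_loop_def using u by blast
qed

text \<open>Taking \<open>z = f x y\<close>, available by closure, turns the membership equivalence
  into the homomorphism equation; injectivity of \<open>\<phi>\<close> gives the converse.\<close>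

lemma isomorphic_quasigroups_iff_table_isomorphic:
  assumes "\<And>x y. x \<in> Q \<Longrightarrow> y \<in> Q \<Longrightarrow> f x y \<in> Q"
  shows "isomorphic_quasigroups (Q, f) (Q', f') \<longleftrightarrow>
    table_isomorphic Q (operation_table Q f) Q' (operation_table Q' f')"
proof -
  have "(\<forall>x \<in> Q. \<forall>y \<in> Q. \<phi> (f x y) = f' (\<phi> x) (\<phi> y)) \<longleftrightarrow>
    (\<forall>x \<in> Q. \<forall>y \<in> Q. \<forall>z \<in> Q. (\<phi> x, \<phi> y, \<phi> z) \<in> operation_table Q' f' \<longleftrightarrow> (x, y, z) \<in> operation_table Q f)"
    (is "?l \<longleftrightarrow> ?r") if \<phi>: "bij_betw \<phi> Q Q'" for \<phi>
  proof -
    have im: "\<phi> x \<in> Q'" if "x \<in> Q" for x using \<phi> that by (rule bij_betwE[rule_format])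
    have mem: "(x, y, z) \<in> operation_table Q f \<longleftrightarrow> z = f x y" if "x \<in> Q" "y \<in> Q" for x y z
      using that unfolding operation_table_def by blast
    have mem': "(\<phi> x, \<phi> y, \<phi> z) \<in> operation_table Q' f' \<longleftrightarrow> \<phi> z = f' (\<phi> x) (\<phi> y)" if "x \<in> Q" "y \<in> Q" for x y z
      using im[OF that(1)] im[OF that(2)] unfolding operation_table_def by blast
    have inj: "\<phi> z = \<phi> w \<longleftrightarrow> z = w" if "z \<in> Q" "w \<in> Q" for z w
      using inj_on_eq_iff[OF bij_betw_imp_inj_on[OF \<phi>] that] .
    have "?r \<longleftrightarrow> (\<forall>x \<in> Q. \<forall>y \<in> Q. \<forall>z \<in> Q. \<phi> z = f' (\<phi> x) (\<phi> y) \<longleftrightarrow> z = f x y)"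
      by (simp add: mem mem')
    also have "\<dots> \<longleftrightarrow> ?l"
    proof (rule iffI; intro ballI)
      fix x y assume "\<forall>x \<in> Q. \<forall>y \<in> Q. \<forall>z \<in> Q. \<phi> z = f' (\<phi> x) (\<phi> y) \<longleftrightarrow> z = f x y" "x \<in> Q" "y \<in> Q"
      then show "\<phi> (f x y) = f' (\<phi> x) (\<phi> y)" using assms by blast
    next
      fix x y z assume h: "?l" and Q: "x \<in> Q" "y \<in> Q" "z \<in> Q"
      have "f' (\<phi> x) (\<phi> y) = \<phi> (f x y)" using h Q by simp
      then show "\<phi> z = f' (\<phi> x) (\<phi> y) \<longleftrightarrow> z = f x y" using inj[OF Q(3) assms[OF Q(1,2)]] by simp
    qed
    finally show ?thesis by (rule sym)
  qed
  then show ?thesis unfolding isomorphic_quasigroups_def table_isomorphic_def prod.case by blast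
qed

section \<open>Representatives and comparison of the counts\<close>

text \<open>Classes formed inside the restricted set may be smaller than those in \<open>A\<close>,
  but either kind separates elements satisfying \<open>P\<close> exactly by \<open>R\<close>, so the
  numbers agree.\<close>

lemma card_classes_containing_eq_card_classes_of:
  assumes R: "reflp_on A R" "symp_on A R" "transp_on A R"
  shows "card (classes_containing A R P) = card (classes_of {x \<in> A. P x} R)"
proof -
  let ?B = "{x \<in> A. P x}"
  have B: "reflp_on ?B R" "symp_on ?B R" "transp_on ?B R"
    by (rule reflp_on_subset[OF R(1)] symp_on_subset[OF R(2)] transp_on_subset[OF R(3)], blast)+
  show ?thesis
    unfolding classes_containing_eq_image[OF R] classes_of_eq_image
  proof (rule card_image_eq_if_same_kernel)
    fix x y assume xy: "x \<in> ?B" "y \<in> ?B"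
    then have A: "x \<in> A" "y \<in> A" by simp_all
    show "{z \<in> A. R x z} = {z \<in> A. R y z} \<longleftrightarrow> {z \<in> ?B. R x z} = {z \<in> ?B. R y z}"
      unfolding class_eq_iff[OF R A] class_eq_iff[OF B xy] ..
  qed
qed

lemma isomorphic_sts_equivalence:
  "reflp_on (steiner_triple_systems n) isomorphic_sts"
  "symp_on (steiner_triple_systems n) isomorphic_sts"
  "transp_on (steiner_triple_systems n) isomorphic_sts"
  by (rule reflp_onI, rule isomorphic_sts_refl)
    (rule symp_onI, erule isomorphic_sts_sym, assumption,
      rule transp_onI, erule isomorphic_sts_trans, assumption)

lemma square_relations_equivalence:
  "reflp_on A (isotopic m)" "symp_on A (isotopic m)" "transp_on A (isotopic m)"
  "reflp_on A (paratopic m)" "symp_on A (paratopic m)" "transp_on A (paratopic m)"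
  "reflp_on A (isomorphic_squares m)" "symp_on A (isomorphic_squares m)"
  "transp_on A (isomorphic_squares m)"
  by (rule reflp_onI symp_onI transp_onI, blast intro: isotopic_refl isotopic_sym isotopic_trans
      paratopic_refl paratopic_sym paratopic_trans isomorphic_squares_refl isomorphic_squares_sym
      isomorphic_squares_trans)+

text \<open>Relocates a system to a prescribed point set, as required to realise it by a square on
  fixed symbols.\<close>

lemma steiner_triple_system_transport:
  assumes T: "T \<in> steiner_triple_systems n" and W: "finite W" "card W = n"
  obtains B where "steiner_triple_system W B" "isomorphic_sts (W, B) T"
proof -
  obtain V C where eq: "T = (V, C)" by (cases T)
  have V: "finite V" "card V = n" "steiner_triple_system V C"
    using T by (simp_all add: eq steiner_triple_systems_def)
  obtain h where h: "bij_betw h V W" using finite_same_card_bij[of V W] V W by auto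
  have "steiner_triple_system W ((\<lambda>b. h ` b) ` C)"
    using steiner_triple_system_image[OF V(3) bij_betw_imp_inj_on[OF h]] bij_betw_imp_surj_on[OF h] by simp
  moreover have "isomorphic_sts T (W, (\<lambda>b. h ` b) ` C)"
    unfolding eq isomorphic_sts_def prod.case using h by blast
  ultimately show thesis using that isomorphic_sts_sym[OF T] by blast
qed

lemma idempotent_table_representative:
  assumes "T \<in> steiner_triple_systems n"
  obtains L where "idempotent_table {1..n} L" "isomorphic_sts ({1..n}, blocks L) T"
proof -
  obtain B where B: "steiner_triple_system {1..n} B" "isomorphic_sts ({1..n}, B) T"
    using steiner_triple_system_transport[OF assms, of "{1..n}"] by auto
  obtain L where "idempotent_table {1..n} L" "blocks L = B"
    by (rule idempotent_table_of_steiner[OF B(1)])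
  then show thesis using that B(2) by simp
qed

lemma unipotent_table_representative:
  assumes "T \<in> steiner_triple_systems n"
  obtains L where "unipotent_table {1..n + 1} 1 L" "isomorphic_sts ({1..n + 1} - {1}, blocks L) T"
proof -
  \<comment> \<open>Shifting the points to \<open>{2..n + 1}\<close> frees 1 for the identity, so
    the square obtained is reduced as well as unipotent.\<close>
  obtain B where B: "steiner_triple_system {2..n + 1} B" "isomorphic_sts ({2..n + 1}, B) T"
    using steiner_triple_system_transport[OF assms, of "{2..n + 1}"] by auto
  obtain L where "unipotent_table (insert 1 {2..n + 1}) 1 L" "blocks L = B"
    by (rule unipotent_table_of_steiner[OF B(1), of 1]) simp
  moreover have "insert 1 {2..n + 1} = {1..n + 1}" "{1..n + 1} - {1} = {2..n + 1}" by auto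
  ultimately show thesis using that B(2) by simp
qed

lemma idempotent_square_iff:
  "latin_square n L \<and> totally_symmetric L \<and> idempotent_square n L \<longleftrightarrow> idempotent_table {1..n} L"
  unfolding idempotent_table_def idempotent_square_def latin_square_totally_symmetric_iff[symmetric] by blast

lemma unipotent_square_iff:
  assumes "m \<ge> 1"
  shows "latin_square m L \<and> totally_symmetric L \<and> unipotent m L \<longleftrightarrow> (\<exists>u. unipotent_table {1..m} u L)"
proof -
  have "u \<in> {1..m}" if "ts_table {1..m} L" "\<forall>i \<in> {1..m}. (i, i, u) \<in> L" for u
  proof -
    \<comment> \<open>\<open>unipotent\<close> does not bound its symbol; cell
      \<open>(1, 1)\<close>, present since \<open>m \<ge> 1\<close>, places it in the
      carrier.\<close>
    have "(1, 1, u) \<in> L" using that(2) assms by simp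
    then show ?thesis by (rule ts_table_mem(3)[OF that(1)])
  qed
  then show ?thesis
    unfolding unipotent_table_def unipotent_def latin_square_totally_symmetric_iff[symmetric] by blast
qed

text \<open>The border triples \<open>(1, i, i)\<close> and \<open>(i, 1, i)\<close> are reorderings
  of the diagonal triple \<open>(i, i, 1)\<close>.\<close>

lemma reduced_square_iff:
  assumes "m \<ge> 1"
  shows "latin_square m L \<and> totally_symmetric L \<and> reduced m L \<longleftrightarrow> unipotent_table {1..m} 1 L"
proof -
  have "reduced m L \<longleftrightarrow> (\<forall>i \<in> {1..m}. (i, i, 1) \<in> L)" if "totally_symmetric L"
    unfolding reduced_def using totally_symmetric_mem_iff[OF that] by blast
  moreover have "1 \<in> {1..m}" using assms by simp
  ultimately show ?thesis
    unfolding unipotent_table_def latin_square_totally_symmetric_iff[symmetric] by blast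
qed

text \<open>The identity is read off the diagonal instead of being a parameter, so that the system
  is a function of the table alone.\<close>

definition steiner_of_unipotent :: "'a set \<Rightarrow> ('a \<times> 'a \<times> 'a) set \<Rightarrow> 'a set \<times> 'a set set" where
  "steiner_of_unipotent Q L = (Q - {u. \<exists>x. (x, x, u) \<in> L}, blocks L)"

lemma steiner_of_unipotent_eq:
  assumes L: "unipotent_table Q u L"
  shows "steiner_of_unipotent Q L = (Q - {u}, blocks L)"
proof -
  have "(u, u, u) \<in> L" using L by (simp add: unipotent_table_def)
  moreover have "v = u" if "(x, x, v) \<in> L" for x v using unipotent_table_mem_iff(1)[OF L that] by simp
  ultimately have "{v. \<exists>x. (x, x, v) \<in> L} = {u}" by blast
  then show ?thesis by (simp add: steiner_of_unipotent_def)
qed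

lemma steiner_of_unipotent_mem:
  assumes L: "unipotent_table Q u L" and "finite Q" "card Q = n + 1"
  shows "steiner_of_unipotent Q L \<in> steiner_triple_systems n"
proof -
  have "u \<in> Q" using L by (simp add: unipotent_table_def)
  then show ?thesis
    using steiner_triple_system_unipotent[OF L] assms
    by (simp add: steiner_of_unipotent_eq[OF L] steiner_triple_systems_def)
qed

lemma table_isomorphic_iff_steiner_of_unipotent:
  assumes "unipotent_table Q u L" "unipotent_table Q' u' L'"
  shows "table_isomorphic Q L Q' L' \<longleftrightarrow>
    isomorphic_sts (steiner_of_unipotent Q L) (steiner_of_unipotent Q' L')"
  unfolding steiner_of_unipotent_eq[OF assms(1)] steiner_of_unipotent_eq[OF assms(2)]
  by (rule table_isomorphic_unipotent_iff[OF assms])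

text \<open>Keeping \<open>R\<close> general serves isomorphism, isotopism and paratopism at once,
  as they agree on idempotent tables.\<close>

lemma card_steiner_eq_card_idempotent:
  assumes R: "reflp_on (latin_squares n) R" "symp_on (latin_squares n) R" "transp_on (latin_squares n) R"
    and iso: "\<And>L L'. idempotent_table {1..n} L \<Longrightarrow> idempotent_table {1..n} L' \<Longrightarrow>
      R L L' \<longleftrightarrow> isomorphic_squares n L L'"
  shows "card (classes_of (steiner_triple_systems n) isomorphic_sts) =
    card (classes_containing (latin_squares n) R (\<lambda>L. totally_symmetric L \<and> idempotent_square n L))"
proof (rule card_classes_containing_eq[OF R isomorphic_sts_equivalence])
  let ?P = "\<lambda>L. totally_symmetric L \<and> idempotent_square n L"
  have P: "L \<in> latin_squares n \<and> ?P L \<longleftrightarrow> idempotent_table {1..n} L" for L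
    unfolding latin_squares_def mem_Collect_eq by (rule idempotent_square_iff)
  {
    fix L assume "L \<in> latin_squares n" "?P L"
    then have "idempotent_table {1..n} L" using P by blast
    then show "({1..n}, blocks L) \<in> steiner_triple_systems n"
      using steiner_triple_system_idempotent by (simp add: steiner_triple_systems_def)
  next
    fix L L' assume "L \<in> latin_squares n" "?P L" "L' \<in> latin_squares n" "?P L'"
    then have L: "idempotent_table {1..n} L" "idempotent_table {1..n} L'" using P by blast+
    then have "ts_table {1..n} L" "ts_table {1..n} L'" by (simp_all add: idempotent_table_def)
    then show "R L L' \<longleftrightarrow> isomorphic_sts ({1..n}, blocks L) ({1..n}, blocks L')"
      by (simp only: iso[OF L] isomorphic_squares_iff_table_isomorphic table_isomorphic_idempotent_iff[OF L])
  next
    fix T assume "T \<in> steiner_triple_systems n"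
    then obtain L where "idempotent_table {1..n} L" "isomorphic_sts ({1..n}, blocks L) T"
      by (rule idempotent_table_representative)
    then show "\<exists>L \<in> latin_squares n. ?P L \<and> isomorphic_sts ({1..n}, blocks L) T" using P by blast
  }
qed

text \<open>\<open>P\<close> may be any property between having diagonal symbol 1 and having some
  diagonal symbol. This covers reduced and unipotent squares together, since every system is
  realised with identity 1.\<close>

lemma card_steiner_eq_card_unipotent:
  assumes R: "reflp_on (latin_squares (n + 1)) R" "symp_on (latin_squares (n + 1)) R"
      "transp_on (latin_squares (n + 1)) R"
    and iso: "\<And>L L' u u'. unipotent_table {1..n + 1} u L \<Longrightarrow> unipotent_table {1..n + 1} u' L' \<Longrightarrow>
      R L L' \<longleftrightarrow> isomorphic_squares (n + 1) L L'"
    and P: "\<And>L. L \<in> latin_squares (n + 1) \<Longrightarrow> P L \<Longrightarrow> \<exists>u. unipotent_table {1..n + 1} u L"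
      "\<And>L. unipotent_table {1..n + 1} 1 L \<Longrightarrow> L \<in> latin_squares (n + 1) \<and> P L"
  shows "card (classes_of (steiner_triple_systems n) isomorphic_sts) =
    card (classes_containing (latin_squares (n + 1)) R P)"
proof (rule card_classes_containing_eq[OF R isomorphic_sts_equivalence])
  fix L assume "L \<in> latin_squares (n + 1)" "P L"
  then obtain u where "unipotent_table {1..n + 1} u L" using P(1) by blast
  then show "steiner_of_unipotent {1..n + 1} L \<in> steiner_triple_systems n"
    by (rule steiner_of_unipotent_mem) simp_all
next
  fix L L' assume "L \<in> latin_squares (n + 1)" "P L" "L' \<in> latin_squares (n + 1)" "P L'"
  then obtain u u' where L: "unipotent_table {1..n + 1} u L" "unipotent_table {1..n + 1} u' L'"
    using P(1) by blast
  then have "ts_table {1..n + 1} L" "ts_table {1..n + 1} L'" by (simp_all add: unipotent_table_def)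
  then show "R L L' \<longleftrightarrow>
      isomorphic_sts (steiner_of_unipotent {1..n + 1} L) (steiner_of_unipotent {1..n + 1} L')"
    by (simp only: iso[OF L] isomorphic_squares_iff_table_isomorphic
        table_isomorphic_iff_steiner_of_unipotent[OF L])
next
  fix T assume "T \<in> steiner_triple_systems n"
  then obtain L where L: "unipotent_table {1..n + 1} 1 L" "isomorphic_sts ({1..n + 1} - {1}, blocks L) T"
    by (rule unipotent_table_representative)
  then show "\<exists>L \<in> latin_squares (n + 1). P L \<and> isomorphic_sts (steiner_of_unipotent {1..n + 1} L) T"
    using P(2)[OF L(1)] steiner_of_unipotent_eq[OF L(1)] by auto
qed

lemma card_steiner_eq_card_ts_loops:
  "card (classes_of (steiner_triple_systems n) isomorphic_sts) =
    card (classes_of (ts_loops (n + 1)) isomorphic_quasigroups)"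
proof -
  let ?F = "\<lambda>(Q, f). steiner_of_unipotent Q (operation_table Q f)"
  have loop: "finite Q" "card Q = n + 1" "\<exists>u. unipotent_table Q u (operation_table Q f)"
    "\<And>x y. x \<in> Q \<Longrightarrow> y \<in> Q \<Longrightarrow> f x y \<in> Q" if "(Q, f) \<in> ts_loops (n + 1)" for Q f
  proof -
    have l: "finite Q" "card Q = n + 1" "is_loop Q f" "totally_symmetric (operation_table Q f)"
      using that by (simp_all add: ts_loops_def)
    show "finite Q" "card Q = n + 1" using l(1,2) .
    show "\<exists>u. unipotent_table Q u (operation_table Q f)" by (rule unipotent_table_operation_table[OF l(3,4)])
    show "f x y \<in> Q" if "x \<in> Q" "y \<in> Q" for x y
      using l(3) that by (simp add: is_loop_def quasigroup_def)
  qed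
  have mem: "?F l \<in> steiner_triple_systems n" if "l \<in> ts_loops (n + 1)" for l
  proof -
    obtain Q f where l: "l = (Q, f)" by (cases l)
    then show ?thesis using loop[of Q f] steiner_of_unipotent_mem that by auto
  qed
  have iso: "isomorphic_quasigroups l l' \<longleftrightarrow> isomorphic_sts (?F l) (?F l')"
    if mems: "l \<in> ts_loops (n + 1)" "l' \<in> ts_loops (n + 1)" for l l'
  proof -
    obtain Q f Q' f' where l: "l = (Q, f)" "l' = (Q', f')" by (metis surj_pair)
    obtain u where u: "unipotent_table Q u (operation_table Q f)"
      using loop(3)[OF mems(1)[unfolded l]] by blast
    obtain u' where u': "unipotent_table Q' u' (operation_table Q' f')"
      using loop(3)[OF mems(2)[unfolded l]] by blast
    have "isomorphic_quasigroups (Q, f) (Q', f') \<longleftrightarrow>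
        table_isomorphic Q (operation_table Q f) Q' (operation_table Q' f')"
      by (rule isomorphic_quasigroups_iff_table_isomorphic[OF loop(4)[OF mems(1)[unfolded l]]])
    then show ?thesis unfolding l prod.case table_isomorphic_iff_steiner_of_unipotent[OF u u'] .
  qed
  \<comment> \<open>Inherited from isomorphism of systems through \<open>iso\<close>, without
    composing or inverting maps between loops.\<close>
  have equiv: "reflp_on (ts_loops (n + 1)) isomorphic_quasigroups"
    "symp_on (ts_loops (n + 1)) isomorphic_quasigroups"
    "transp_on (ts_loops (n + 1)) isomorphic_quasigroups"
  proof -
    show "reflp_on (ts_loops (n + 1)) isomorphic_quasigroups"
      by (rule reflp_onI) (simp add: iso isomorphic_sts_refl)
    show "symp_on (ts_loops (n + 1)) isomorphic_quasigroups"
      by (rule symp_onI) (use iso isomorphic_sts_sym[OF mem] in blast)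
    show "transp_on (ts_loops (n + 1)) isomorphic_quasigroups"
      by (rule transp_onI) (use iso isomorphic_sts_trans in blast)
  qed
  show ?thesis
    unfolding classes_of_eq_classes_containing[OF equiv(1)]
  proof (rule card_classes_containing_eq[OF equiv isomorphic_sts_equivalence])
    fix T assume "T \<in> steiner_triple_systems n"
    then obtain L where L: "unipotent_table {1..n + 1} 1 L" "isomorphic_sts ({1..n + 1} - {1}, blocks L) T"
      by (rule unipotent_table_representative)
    obtain f where f: "is_loop {1..n + 1} f" "operation_table {1..n + 1} f = L"
      by (rule loop_of_unipotent_table[OF L(1)])
    have "totally_symmetric L" using L(1) by (simp add: unipotent_table_def ts_table_def)
    then have "({1..n + 1}, f) \<in> ts_loops (n + 1)" using f by (simp add: ts_loops_def)
    moreover have "isomorphic_sts (?F ({1..n + 1}, f)) T"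
      using L(2) by (simp only: prod.case f(2) steiner_of_unipotent_eq[OF L(1)])
    ultimately show "\<exists>l \<in> ts_loops (n + 1). True \<and> isomorphic_sts (?F l) T" by blast
  qed (use mem iso in simp_all)
qed

theorem theorem17:
  fixes n :: nat
  assumes "n \<ge> 1"
  shows
    "card (classes_of (steiner_triple_systems n) isomorphic_sts) =
       card (classes_of {L \<in> latin_squares n. totally_symmetric L \<and> idempotent_square n L}
        (isomorphic_squares n)) \<and>
     card (classes_of (steiner_triple_systems n) isomorphic_sts) =
       card (classes_containing (latin_squares n) (isotopic n)
        (\<lambda>L. totally_symmetric L \<and> idempotent_square n L)) \<and>
     card (classes_of (steiner_triple_systems n) isomorphic_sts) =
       card (classes_containing (latin_squares n) (paratopic n)
        (\<lambda>L. totally_symmetric L \<and> idempotent_square n L)) \<and>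
     card (classes_of (steiner_triple_systems n) isomorphic_sts) =
       card (classes_of (ts_loops (n + 1)) isomorphic_quasigroups) \<and>
     card (classes_of (steiner_triple_systems n) isomorphic_sts) =
       card (classes_of {L \<in> latin_squares (n + 1). totally_symmetric L \<and> unipotent (n + 1) L}
        (isomorphic_squares (n + 1))) \<and>
     card (classes_of (steiner_triple_systems n) isomorphic_sts) =
       card (classes_containing (latin_squares (n + 1)) (isomorphic_squares (n + 1))
        (\<lambda>L. totally_symmetric L \<and> reduced (n + 1) L)) \<and>
     card (classes_of (steiner_triple_systems n) isomorphic_sts) =
       card (classes_containing (latin_squares (n + 1)) (isotopic (n + 1))
        (\<lambda>L. totally_symmetric L \<and> unipotent (n + 1) L)) \<and>
     card (classes_of (steiner_triple_systems n) isomorphic_sts) =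
       card (classes_containing (latin_squares (n + 1)) (isotopic (n + 1))
        (\<lambda>L. totally_symmetric L \<and> reduced (n + 1) L)) \<and>
     card (classes_of (steiner_triple_systems n) isomorphic_sts) =
       card (classes_containing (latin_squares (n + 1)) (paratopic (n + 1))
        (\<lambda>L. totally_symmetric L \<and> unipotent (n + 1) L)) \<and>
     card (classes_of (steiner_triple_systems n) isomorphic_sts) =
       card (classes_containing (latin_squares (n + 1)) (paratopic (n + 1))
        (\<lambda>L. totally_symmetric L \<and> reduced (n + 1) L))"
proof -
  let ?sts = "card (classes_of (steiner_triple_systems n) isomorphic_sts)"
  let ?idem = "\<lambda>L. totally_symmetric L \<and> idempotent_square n L"
  let ?uni = "\<lambda>L. totally_symmetric L \<and> unipotent (n + 1) L"
  let ?red = "\<lambda>L. totally_symmetric L \<and> reduced (n + 1) L"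
  have m: "n + 1 \<ge> 1" by simp
  note equiv = square_relations_equivalence
  have idem: "?sts = card (classes_containing (latin_squares n) R ?idem)"
    if "R \<in> {isomorphic_squares n, isotopic n, paratopic n}" for R
  proof (rule card_steiner_eq_card_idempotent)
    show "reflp_on (latin_squares n) R" "symp_on (latin_squares n) R" "transp_on (latin_squares n) R"
      using that equiv by blast+
    fix L L' assume L: "idempotent_table {1..n} L" "idempotent_table {1..n} L'"
    then have "totally_symmetric L'" by (simp add: idempotent_table_def ts_table_def)
    \<comment> \<open>Symmetry of \<open>L'\<close> absorbs the coordinate permutation, so a
      paratopism leaves an isotopism.\<close>
    then show "R L L' \<longleftrightarrow> isomorphic_squares n L L'"
      using that paratopic_iff_isotopic[of L' n L] isotopic_iff_isomorphic_idempotent[OF L] by blast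
  qed
  have unip: "?sts = card (classes_containing (latin_squares (n + 1)) R P)"
    if R: "R \<in> {isomorphic_squares (n + 1), isotopic (n + 1), paratopic (n + 1)}"
      and P: "P \<in> {?uni, ?red}" for R P
  proof (rule card_steiner_eq_card_unipotent)
    show "reflp_on (latin_squares (n + 1)) R" "symp_on (latin_squares (n + 1)) R"
      "transp_on (latin_squares (n + 1)) R"
      using R equiv by blast+
    fix L
    show "\<exists>u. unipotent_table {1..n + 1} u L" if "L \<in> latin_squares (n + 1)" "P L"
      using that P unipotent_square_iff[OF m, of L] reduced_square_iff[OF m, of L]
      unfolding latin_squares_def by blast
    show "L \<in> latin_squares (n + 1) \<and> P L" if "unipotent_table {1..n + 1} 1 L"
      using that P unipotent_square_iff[OF m, of L] reduced_square_iff[OF m, of L]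
      unfolding latin_squares_def by blast
  next
    fix L L' u u'
    assume L: "unipotent_table {1..n + 1} u L" "unipotent_table {1..n + 1} u' L'"
    then have "totally_symmetric L'" by (simp add: unipotent_table_def ts_table_def)
    then show "R L L' \<longleftrightarrow> isomorphic_squares (n + 1) L L'"
      using R paratopic_iff_isotopic[of L' "n + 1" L] isotopic_iff_isomorphic_unipotent[OF L] by blast
  qed
  \<comment> \<open>Here and in the next fact the classes are formed among the special squares only,
    so the count over all Latin squares is restricted.\<close>
  have "?sts = card (classes_of {L \<in> latin_squares n. ?idem L} (isomorphic_squares n))"
    using idem[of "isomorphic_squares n"] by (simp add: card_classes_containing_eq_card_classes_of equiv)
  moreover have "?sts = card (classes_of {L \<in> latin_squares (n + 1). ?uni L} (isomorphic_squares (n + 1)))"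
    using unip[of "isomorphic_squares (n + 1)" ?uni]
      card_classes_containing_eq_card_classes_of[OF equiv(7-9)[of "latin_squares (n + 1)" "n + 1"], of ?uni]
    by simp
  ultimately show ?thesis
    by (intro conjI idem unip card_steiner_eq_card_ts_loops insertI1 insertI2)
qed

end
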